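(* Let $n \ge 1$ and let $A, B, C, D$ be diagonal complex-valued $n \times n$ matrices. Then for all real $p$ with $1 \le p \le 2$, $$\left\| \begin{pmatrix} A & B \\ C & D \end{pmatrix} \right\|_p \;\ge\; \left\| \begin{pmatrix} |A| & |B| \\ |C| & |D| \end{pmatrix} \right\|_p \;\ge\; \left\| \begin{pmatrix} \|A\|_p & \|B\|_p \\ \|C\|_p & \|D\|_p \end{pmatrix} \right\|_p ,$$ where the first two matrices are $2n \times 2n$ block matrices and the third is a $2 \times 2$ matrix with nonnegative real entries. For all real $p \ge 2$ both inequalities hold in the reverse direction, i.e. with each $\ge$ replaced by $\le$.
   Context: For a square complex matrix $X$, $|X| = (X^* X)^{1/2}$ is the positive semidefinite square root of $X^*X$, and for real $p \ge 1$ the trace (Schatten) $p$-norm is $\|X\|_p = \left( \operatorname{Tr} |X|^p \right)^{1/p} = \left( \operatorname{Tr} (X^*X)^{p/2} \right)^{1/p}$. *)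

theory Defs
  imports "Jordan_Normal_Form.Schur_Decomposition" Complex_Main
begin

definition mat_trace :: "complex mat \<Rightarrow> complex" where
  "mat_trace A = (\<Sum>i<dim_row A. A $$ (i, i))"

definition unitary_mat :: "nat \<Rightarrow> complex mat \<Rightarrow> bool" where
  "unitary_mat n U \<longleftrightarrow> U \<in> carrier_mat n n \<and> mat_adjoint U * U = 1\<^sub>m n"

(* The quadratic form of a Hermitian matrix is real, so only its real part matters. *)
definition psd_mat :: "nat \<Rightarrow> complex mat \<Rightarrow> bool" where
  "psd_mat n P \<longleftrightarrow> P \<in> carrier_mat n n \<and> mat_adjoint P = P \<and>
     (\<forall>v \<in> carrier_vec n. 0 \<le> Re ((P *\<^sub>v v) \<bullet>c v))"

definition mat_abs :: "complex mat \<Rightarrow> complex mat" where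
  "mat_abs X = (THE P. psd_mat (dim_row X) P \<and> P * P = mat_adjoint X * X)"

(* Functional calculus for a positive semidefinite P = U diag(d) U^*:
   P^s = U diag(d^s) U^*, which does not depend on the chosen diagonalization.
   Since 0 powr s = 0, this is the usual power for s > 0. *)
definition psd_powr :: "complex mat \<Rightarrow> real \<Rightarrow> complex mat" where
  "psd_powr P s = (THE Q. \<exists>U d.
      unitary_mat (dim_row P) U \<and> (\<forall>i<dim_row P. 0 \<le> d i) \<and>
      P = U * mat_diag (dim_row P) (\<lambda>i. complex_of_real (d i)) * mat_adjoint U \<and>
      Q = U * mat_diag (dim_row P) (\<lambda>i. complex_of_real (d i powr s)) * mat_adjoint U)"

(* The trace is real and nonnegative; Re only converts its type. *)
definition schatten_norm :: "real \<Rightarrow> complex mat \<Rightarrow> real" where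
  "schatten_norm p X = Re (mat_trace (psd_powr (mat_abs X) p)) powr (1 / p)"

end

theory Submission
  imports Defs "HOL-Analysis.Henstock_Kurzweil_Integration"
begin

text \<open>
  Up to a simultaneous permutation of rows and columns the block matrix is the direct sum of the
  matrices \<open>M\<^sub>i = [[a\<^sub>i, b\<^sub>i], [c\<^sub>i, d\<^sub>i]]\<close>, so the \<open>p\<close>-th power of its norm is the sum of \<open>s\<^sup>p + r\<^sup>p\<close> over the
  pairs of singular values \<open>s\<close>, \<open>r\<close> of the \<open>M\<^sub>i\<close>.

  First inequality: passing to absolute values keeps \<open>s\<^sup>2 + r\<^sup>2\<close> and does not increase \<open>s r = |det M\<^sub>i|\<close>;
  the claim is then concavity (convexity) of \<open>x \<mapsto> x\<^bsup>p/2\<^esup>\<close>.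

  Second inequality: for nonnegative entries, \<open>s\<^sup>p + r\<^sup>p\<close> is a positively homogeneous function of degree one
  of \<open>(a\<^sup>p, b\<^sup>p, c\<^sup>p, d\<^sup>p)\<close>, and it suffices that it is convex for \<open>p \<le> 2\<close> and concave for \<open>p \<ge> 2\<close>.
  Writing \<open>s + r\<close> and \<open>s - r\<close> as the lengths of the plane vectors \<open>(a + d, c - b)\<close> and \<open>(a - d, b + c)\<close>
  (case \<open>ad > bc\<close>), the second derivative along a segment turns out to be a combination of just three squares,
  those of the angular velocities of the two vectors and of the derivative of \<open>log (ad/(bc))\<close>. After
  multiplication by \<open>2 - p\<close> all three coefficients are nonnegative.
\<close>

section \<open>The second derivative of the singular value sum\<close>

text \<open>Here \<open>ta\<close>, \<open>tb\<close>, \<open>tc\<close>, \<open>td\<close> are the logarithmic derivatives of the entries.\<close>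

lemma hessian_polynomial_identity:
  fixes a b c d :: real
  assumes "PP = (a+d)^2+(c-b)^2" "QQ = (a-d)^2+(b+c)^2" "D = a*d-b*c"
    "v1 = a*ta" "v2 = b*tb" "v3 = c*tc" "v4 = d*td"
  shows "(PP * ((a-d)*(v1-v4)+(b+c)*(v2+v3)) - QQ * ((a+d)*(v1+v4)+(c-b)*(v3-v2)))^2
     + 4*D*PP*QQ*(b*c*(tb-tc)^2 - a*d*(ta-td)^2)
    = 4*D*(QQ*((a+d)*(v3-v2)-(c-b)*(v1+v4))^2 - PP*((a-d)*(v2+v3)-(b+c)*(v1-v4))^2)
     + 4*PP*QQ*(a*b*c*d)*(ta+td-tb-tc)^2"
  using assms by Groebner_Basis.algebra

text \<open>Lagrange's identity: the squares of the radial and tangential parts of a plane velocity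
  add up to the squared speed. It trades the squared derivative of a length for the squared
  tangential part.\<close>

lemma lagrange_identity_quotient:
  fixes u v x y q :: real
  assumes "q \<noteq> 0" "q^2 = u^2+v^2"
  shows "((u*x+v * y)/q)^2 = x^2+y^2 - ((u*y-v * x)/q)^2"
proof -
  have "(u*x+v * y)^2 + (u*y-v * x)^2 = (x^2+y^2)*q^2"
    unfolding assms(2) by (simp add: algebra_simps power2_eq_square)
  then have "((u*x+v * y)^2 + (u*y-v * x)^2)/q^2 = x^2+y^2" using assms(1) by simp
  then have "(u*x+v * y)^2/q^2 + (u*y-v * x)^2/q^2 = x^2+y^2" by (simp only: add_divide_distrib)
  then show ?thesis unfolding power_divide by linarith
qed

text \<open>
  \<open>P1\<close>, \<open>P2\<close>, \<open>Q1\<close>, \<open>Q2\<close> are the derivatives of \<open>s + r\<close> and \<open>s - r\<close> when the logarithmic derivatives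
  satisfy \<open>t' = -p t\<^sup>2\<close>, and \<open>S\<close>, \<open>R\<close> stand for \<open>s\<^bsup>p-1\<^esup>\<close>, \<open>r\<^bsup>p-1\<^esup>\<close>. In this form the identity is linear in \<open>S\<close> and \<open>R\<close>.
\<close>

lemma hessian_identity:
  fixes a b c d S R :: real
  assumes pos: "a>0" "b>0" "c>0" "d>0" "s>0" "r>0" "s>r"
    and P: "(s+r)^2 = (a+d)^2+(c-b)^2" and Q: "(s-r)^2 = (a-d)^2+(b+c)^2"
    and \<omega>: "\<omega> = ((a+d)*(c*tc-b*tb)-(c-b)*(a*ta+d*td)) / (s+r)"
    and \<psi>: "\<psi> = ((a-d)*(b*tb+c*tc)-(b+c)*(a*ta-d*td)) / (s-r)"
    and P1: "P1 = ((a+d)*(a*ta+d*td)+(c-b)*(c*tc-b*tb)) / (s+r)"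
    and Q1: "Q1 = ((a-d)*(a*ta-d*td)+(b+c)*(b*tb+c*tc)) / (s-r)"
    and P2: "P2 = (\<omega>^2 + (1-p)*((a+d)*(a*ta^2+d*td^2)+(c-b)*(c*tc^2-b*tb^2))) / (s+r)"
    and Q2: "Q2 = (\<psi>^2 + (1-p)*((a-d)*(a*ta^2-d*td^2)+(b+c)*(b*tb^2+c*tc^2))) / (s-r)"
    and Y: "Y = (s*R-r*S) / (s^2-r^2)"
  shows "(p-1)*(S/s*((P1+Q1)/2)^2 + R/r*((P1-Q1)/2)^2) + S*((P2+Q2)/2) + R*((P2-Q2)/2)
    = (p-1)*Y*(\<omega>^2-\<psi>^2+a*b*c*d/(s*r)*(ta+td-tb-tc)^2)
     + (2-p)/2*((S+R)/(s+r)*\<omega>^2 + (S-R)/(s-r)*\<psi>^2)"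
proof -
  \<comment> \<open>\<open>X\<close> and \<open>Y\<close> solve \<open>S = X*s + Y*r\<close>,
    \<open>R = X*r + Y*s\<close>; the quotients \<open>S/s\<close>, \<open>R/r\<close>,
    \<open>(S+R)/(s+r)\<close> and \<open>(S-R)/(s-r)\<close> are linear in them.\<close>
  define X where "X = (s*S-r*R) / (s^2-r^2)"
  have sr2: "s^2-r^2 = (s+r)*(s-r)" by (simp add: algebra_simps power2_eq_square)
  have nz: "s+r \<noteq> 0" "s-r \<noteq> 0" "s \<noteq> 0" "r \<noteq> 0" "s^2-r^2 \<noteq> 0" using pos unfolding sr2 by auto
  have "X * s+Y*r = S*(s^2-r^2)/(s^2-r^2)" "X*r+Y * s = R*(s^2-r^2)/(s^2-r^2)"
    unfolding X_def Y times_divide_eq_left add_divide_distrib[symmetric]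
    by (simp_all add: algebra_simps power2_eq_square)
  then have S: "S = X * s+Y*r" and R: "R = X*r+Y * s" using nz(5) by simp_all
  have D: "s*r = a*d-b*c" using P Q by (simp add: algebra_simps power2_eq_square)
  have SR: "(S+R)/(s+r) = X+Y" "(S-R)/(s-r) = X-Y" unfolding S R using nz by (simp_all add: field_simps)
  have P1sq: "P1^2 = (a*ta+d*td)^2+(c*tc-b*tb)^2 - \<omega>^2"
    unfolding P1 \<omega> by (rule lagrange_identity_quotient[OF nz(1) P])
  have Q1sq: "Q1^2 = (a*ta-d*td)^2+(b*tb+c*tc)^2 - \<psi>^2"
    unfolding Q1 \<psi> by (rule lagrange_identity_quotient[OF nz(2) Q])
  \<comment> \<open>\<open>L\<close> is what completing the square leaves of
    \<open>r/s*x^2 + s/r*y^2\<close> besides the cross term \<open>2*x*y\<close>, taken at the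
    derivatives of \<open>s\<close> and \<open>r\<close>.\<close>
  define L where "L = (((s+r)*Q1-(s-r)*P1)/2)^2/(s*r)"
  have "r/s*x^2 + s/r*y^2 = (r*x-s*y)^2/(s*r) + 2*x*y" for x y
    using nz by (simp add: field_simps power2_eq_square)
  from this[of "(P1+Q1)/2" "(P1-Q1)/2"]
  have L: "r/s*((P1+Q1)/2)^2 + s/r*((P1-Q1)/2)^2 = L + (P1^2-Q1^2)/2"
    by (simp add: L_def algebra_simps power2_eq_square add_divide_distrib diff_divide_distrib)
  \<comment> \<open>Clearing denominators by \<open>4*(s*r)*(s+r)^2*(s-r)^2\<close> turns this into
    \<open>hessian_polynomial_identity\<close>, with \<open>s*r\<close> as the determinant and
    \<open>(s+r)^2\<close>, \<open>(s-r)^2\<close> as the squared lengths.\<close>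
  have key: "L + b*c*(tb-tc)^2 - a*d*(ta-td)^2 = \<omega>^2-\<psi>^2+a*b*c*d/(s*r)*(ta+td-tb-tc)^2"
  proof -
    define p1 q1 where "p1 = (a+d)*(a*ta+d*td)+(c-b)*(c*tc-b*tb)" "q1 = (a-d)*(a*ta-d*td)+(b+c)*(b*tb+c*tc)"
    note pq = this
    have e: "(s+r)*(s-r)*((s+r)*Q1-(s-r)*P1) = (s+r)^2*q1 - (s-r)^2 * p1"
      unfolding P1 Q1 pq[symmetric] using nz by (simp add: field_simps power2_eq_square)
    have L1: "4*(s*r)*(s+r)^2*(s-r)^2 * ((Z/2)^2/(s*r)) = ((s+r)*(s-r)*Z)^2" for Z
      using nz by (simp add: power_mult_distrib power_divide)
    have om1: "(s+r)^2 * \<omega>^2 = ((a+d)*(c*tc-b*tb)-(c-b)*(a*ta+d*td))^2"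
      and ch1: "(s-r)^2 * \<psi>^2 = ((a-d)*(b*tb+c*tc)-(b+c)*(a*ta-d*td))^2"
      unfolding \<omega> \<psi> using nz by (simp_all add: power_divide)
    have "4*(s*r)*(s+r)^2*(s-r)^2 * (L + b*c*(tb-tc)^2 - a*d*(ta-td)^2)
        = ((s+r)*(s-r)*((s+r)*Q1-(s-r)*P1))^2 + 4*(s*r)*(s+r)^2*(s-r)^2 * (b*c*(tb-tc)^2 - a*d*(ta-td)^2)"
      unfolding L1[symmetric] L_def by (simp only: add_diff_eq[symmetric] distrib_left)
    also have "\<dots> = 4*(s*r)*((s-r)^2*((s+r)^2 * \<omega>^2) - (s+r)^2*((s-r)^2 * \<psi>^2))
       + 4*(s+r)^2*(s-r)^2*(a*b*c*d)*(ta+td-tb-tc)^2"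
      unfolding e om1 ch1 pq by (rule hessian_polynomial_identity[OF P Q D]) simp_all
    also have "\<dots> = 4*(s*r)*(s+r)^2*(s-r)^2 * (\<omega>^2-\<psi>^2+a*b*c*d/(s*r)*(ta+td-tb-tc)^2)"
    proof -
      have "4*(s*r)*(V*(U*x) - U*(V*y)) + 4*U*V*z*w = 4*(s*r)*U*V*(x-y+z/(s*r)*w)" for U V x y z w :: real
        using nz by (simp add: field_simps)
      then show ?thesis .
    qed
    finally show ?thesis using nz by simp
  qed
  have "S/s = X+Y*(r/s)" "R/r = X+Y*(s/r)" unfolding S R using nz by (simp_all add: field_simps)
  then have "S/s*((P1+Q1)/2)^2 + R/r*((P1-Q1)/2)^2
      = X*(((P1+Q1)/2)^2+((P1-Q1)/2)^2) + Y*(r/s*((P1+Q1)/2)^2 + s/r*((P1-Q1)/2)^2)"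
    by (simp only: distrib_left distrib_right mult.assoc)
  moreover have "((P1+Q1)/2)^2+((P1-Q1)/2)^2 = (P1^2+Q1^2)/2" by (simp add: field_simps power2_eq_square)
  ultimately have t1: "S/s*((P1+Q1)/2)^2 + R/r*((P1-Q1)/2)^2 = X*((P1^2+Q1^2)/2) + Y*(L + (P1^2-Q1^2)/2)"
    by (simp only: L)
  have P2': "(S+R)*P2 = (X+Y)*(\<omega>^2 + (1-p)*((a+d)*(a*ta^2+d*td^2)+(c-b)*(c*tc^2-b*tb^2)))"
    unfolding P2 SR(1)[symmetric] by simp
  have Q2': "(S-R)*Q2 = (X-Y)*(\<psi>^2 + (1-p)*((a-d)*(a*ta^2-d*td^2)+(b+c)*(b*tb^2+c*tc^2)))"
    unfolding Q2 SR(2)[symmetric] by simp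
  have "S*((P2+Q2)/2) + R*((P2-Q2)/2) = ((S+R)*P2+(S-R)*Q2)/2" by (simp add: field_simps)
  note t2 = this[unfolded P2' Q2']
  have L2: "L = \<omega>^2-\<psi>^2+a*b*c*d/(s*r)*(ta+td-tb-tc)^2 - b*c*(tb-tc)^2 + a*d*(ta-td)^2"
    using key by simp
  define e where "e = a*b*c*d/(s*r)*(ta+td-tb-tc)^2"
  define va vb vc vd where v: "va = a*ta" "vb = b*tb" "vc = c*tc" "vd = d*td"
  have o: "(P1^2+Q1^2)/2 = va^2+vb^2+vc^2+vd^2 - (\<omega>^2+\<psi>^2)/2"
    "L + (P1^2-Q1^2)/2 = (\<omega>^2-\<psi>^2)/2 + e + a*d*(ta^2+td^2) - b*c*(tb^2+tc^2)"
    unfolding P1sq Q1sq L2 e_def[symmetric] v by (simp_all add: field_simps power2_eq_square)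
  have u: "(X+Y)*(\<omega>^2 + (1-p)*((a+d)*(a*ta^2+d*td^2)+(c-b)*(c*tc^2-b*tb^2)))
      + (X-Y)*(\<psi>^2 + (1-p)*((a-d)*(a*ta^2-d*td^2)+(b+c)*(b*tb^2+c*tc^2)))
     = (X+Y)*\<omega>^2 + (X-Y)*\<psi>^2 + 2*(1-p)*X*(va^2+vb^2+vc^2+vd^2)
       + 2*(1-p)*Y*(a*d*(ta^2+td^2) - b*c*(tb^2+tc^2))"
    unfolding v by (simp add: algebra_simps power2_eq_square)
  \<comment> \<open>The factors \<open>p-1\<close> and \<open>1-p\<close> meet here: the squared
    speeds and the terms in \<open>a*d\<close> and \<open>b*c\<close> cancel, leaving only \<omega>,
    \<psi> and \<open>e\<close>.\<close>
  have "(p-1)*(X*((P1^2+Q1^2)/2) + Y*(L + (P1^2-Q1^2)/2)) + ((X+Y)*(\<omega>^2 + (1-p)*((a+d)*(a*ta^2+d*td^2)+(c-b)*(c*tc^2-b*tb^2)))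
      + (X-Y)*(\<psi>^2 + (1-p)*((a-d)*(a*ta^2-d*td^2)+(b+c)*(b*tb^2+c*tc^2))))/2
     = (p-1)*Y*(\<omega>^2-\<psi>^2+e) + (2-p)/2*((X+Y)*\<omega>^2 + (X-Y)*\<psi>^2)"
    unfolding o u by (simp add: algebra_simps add_divide_distrib diff_divide_distrib)
  then show ?thesis unfolding t1 SR add.assoc t2 e_def .
qed

section \<open>Inequalities between powers\<close>

text \<open>The expression and its first derivative vanish at 1, and its second derivative is
  \<open>(1-k)^2*(1+k)*k*y powr (k-2)*(y-1)\<close>. The outer factor \<open>1-k\<close> becomes a
  square there, which covers \<open>k < 1\<close> and \<open>k > 1\<close> at once.\<close>

lemma powr_polynomial_ineq:
  fixes y k :: real assumes "1 \<le> y" "k > 0"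
  shows "0 \<le> (1-k)*((1-k)*y powr (k+1) + (1+k)*y powr k - (1+k)*y - (1-k))"
proof -
  define F where "F y = (1-k)*((1-k)*y powr (k+1) + (1+k)*y powr k - (1+k)*y - (1-k))" for y
  define F1 where "F1 y = (1-k)*((1-k)*((k+1)*y powr k) + (1+k)*(k*y powr (k-1)) - (1+k))" for y
  define F2 where "F2 y = (1-k)*((1-k)*((k+1)*(k*y powr (k-1))) + (1+k)*(k*((k-1)*y powr (k-2))))" for y
  have D: "(F has_real_derivative F1 y) (at y)" if "y \<ge> 1" for y
    unfolding F_def F1_def using that by (auto intro!: derivative_eq_intros)
  have D1: "(F1 has_real_derivative F2 y) (at y)" if "y \<ge> 1" for y
    unfolding F1_def F2_def using that by (auto intro!: derivative_eq_intros)
  have F2: "F2 y \<ge> 0" if "y \<ge> 1" for y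
  proof -
    have "y powr (k-1) = y powr (k-2) * y" using that by (simp add: powr_mult_base[of y "k-2"] mult.commute)
    then have "F2 y = (1-k)^2*((1+k)*k)*(y powr (k-2)*(y-1))"
      unfolding F2_def by (simp add: algebra_simps power2_eq_square)
    then show ?thesis using that assms by simp
  qed
  have F11: "F1 1 = 0" unfolding F1_def by (simp add: algebra_simps)
  have F1: "F1 y \<ge> 0" if "y \<ge> 1" for y
    using DERIV_nonneg_imp_nondecreasing[of 1 y F1] D1 F2 that F11 by force
  have "F 1 = 0" unfolding F_def by (simp add: algebra_simps)
  then have "F y \<ge> 0"
    using DERIV_nonneg_imp_nondecreasing[of 1 y F] D F1 assms by force
  then show ?thesis unfolding F_def .
qed

text \<open>These fix the signs of the coefficients of the second derivative. The first is
  monotonicity of \<open>x powr (p-2)\<close>; the second is homogeneous, hence a statement about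
  \<open>s/r\<close>, namely \<open>powr_polynomial_ineq\<close> with
  \<open>k = p-1\<close>.\<close>

lemma powr_difference_ineqs:
  fixes s r p :: real assumes "0 < r" "r < s" "1 < p"
  shows "0 \<le> (2-p)*(s*r powr (p-1) - r * s powr (p-1))" (is ?A)
   and "0 \<le> (2-p)*((2-p)/2*(s powr (p-1) - r powr (p-1))*(s+r) - (p-1)*(s*r powr (p-1) - r * s powr (p-1)))" (is ?B)
proof -
  have s: "s powr (p-1) = s * s powr (p-2)" "r powr (p-1) = r * r powr (p-2)"
    using assms by (simp_all add: powr_mult_base)
  have "0 \<le> (2-p)*(r powr (p-2) - s powr (p-2))"
  proof (cases "p \<le> 2")
    case True
    then have "s powr (p-2) \<le> r powr (p-2)" using assms by (intro powr_mono2') auto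
    then show ?thesis using True by simp
  next
    case False
    then have "r powr (p-2) \<le> s powr (p-2)" using assms by (intro powr_mono2) auto
    then show ?thesis using False by (intro mult_nonpos_nonpos) auto
  qed
  then have "0 \<le> s*r*((2-p)*(r powr (p-2) - s powr (p-2)))" using assms by simp
  then show ?A unfolding s by (simp add: algebra_simps)
  define y where "y = s/r"
  have y: "y \<ge> 1" and sy: "s = r*y" using assms by (auto simp: y_def field_simps)
  have sp: "s powr (p-1) = r powr (p-1) * y powr (p-1)" unfolding sy using assms y by (simp add: powr_mult)
  have yp: "y powr (p - 1 + 1) = y * y powr (p-1)" using y by (simp add: powr_mult_base[of y "p-1"])
  have "0 \<le> r powr (p-1)*r/2 * ((1-(p-1))*((1-(p-1))*y powr (p-1+1) + (1+(p-1))*y powr (p-1) - (1+(p-1))*y - (1-(p-1))))"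
    using assms by (intro mult_nonneg_nonneg[OF _ powr_polynomial_ineq[OF y]]) auto
  also have "\<dots> = (2-p)*((2-p)/2*(s powr (p-1) - r powr (p-1))*(s+r) - (p-1)*(s*r powr (p-1) - r * s powr (p-1)))"
    unfolding sp yp unfolding sy by (simp add: field_simps) 
  finally show ?B .
qed

section \<open>Signed powers and lengths of plane vectors\<close>

text \<open>The signed power is the difference of the powers of the positive and negative parts,
  which removes the jump of \<open>sgn\<close> at 0.\<close>

lemma continuous_on_sgn_powr:
  fixes f :: "real \<Rightarrow> real"
  assumes "continuous_on S f" "k > 0"
  shows "continuous_on S (\<lambda>x. sgn (f x) * \<bar>f x\<bar> powr k)"
proof -
  have "sgn y * \<bar>y\<bar> powr k = max y 0 powr k - max (-y) 0 powr k" for y :: real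
    using assms(2) by (cases y "0::real" rule: linorder_cases) auto
  then show ?thesis using assms by (auto intro!: continuous_intros continuous_on_powr')
qed

lemma has_real_derivative_sgn_powr:
  fixes x :: real assumes "x > 0"
  shows "((\<lambda>x. sgn x * \<bar>x\<bar> powr k) has_real_derivative k * x powr (k-1)) (at x)"
proof -
  have "eventually (\<lambda>y. y \<in> {0<..}) (nhds x)" using assms by (intro eventually_nhds_in_open) auto
  then have "eventually (\<lambda>y. sgn y * \<bar>y\<bar> powr k = y powr k) (nhds x)"
    by (rule eventually_mono) auto
  then show ?thesis
    using has_real_derivative_powr[OF assms, of k] by (subst DERIV_cong_ev[OF refl _ refl])
qed

text \<open>At 0 the difference quotient is the signed power of exponent \<open>p-1 > 0\<close>,
  which is continuous with value 0. This point corresponds to a singular matrix.\<close>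

lemma has_real_derivative_abs_powr:
  fixes x :: real assumes "p > 1"
  shows "((\<lambda>x. \<bar>x\<bar> powr p) has_real_derivative p * (sgn x * \<bar>x\<bar> powr (p-1))) (at x)"
proof -
  consider "x > 0" | "x < 0" | "x = 0" by linarith
  then show ?thesis
  proof cases
    case 1
    have "eventually (\<lambda>y. \<bar>y\<bar> powr p = y powr p) (nhds x)"
      using eventually_nhds_in_open[of "{0<..}" x] 1 by (auto elim!: eventually_mono)
    then show ?thesis using has_real_derivative_powr[OF 1, of p] 1 by (subst DERIV_cong_ev[OF refl _ refl]) auto
  next
    case 2
    have "eventually (\<lambda>y. \<bar>y\<bar> powr p = (-y) powr p) (nhds x)"
      using eventually_nhds_in_open[of "{..<0}" x] 2 by (auto elim!: eventually_mono)
    moreover have "((\<lambda>y. (-y) powr p) has_real_derivative p * (-x) powr (p-1) * (-1)) (at x)"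
      using 2 by (auto intro!: derivative_eq_intros)
    ultimately show ?thesis using 2 by (subst DERIV_cong_ev[OF refl _ refl]) auto
  next
    case 3
    have "continuous_on UNIV (\<lambda>y. sgn y * \<bar>y\<bar> powr (p-1))"
      using assms by (intro continuous_on_sgn_powr continuous_intros) auto
    then have "((\<lambda>y. sgn y * \<bar>y\<bar> powr (p-1)) \<longlongrightarrow> 0) (at (0::real))"
      by (simp add: continuous_on_def, drule_tac spec[of _ 0]) simp
    moreover have "sgn y * \<bar>y\<bar> powr (p-1) = \<bar>y\<bar> powr p / y" for y :: real
    proof -
      have "\<bar>y\<bar> powr p = \<bar>y\<bar> * \<bar>y\<bar> powr (p-1)" by (cases "y = 0") (simp_all add: powr_mult_base)
      then show ?thesis by (simp add: sgn_if)
    qed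
    ultimately show ?thesis unfolding DERIV_def using 3 assms by simp
  qed
qed

lemma has_real_derivative_norm2:
  fixes u v u1 v1 :: "real \<Rightarrow> real"
  assumes "(u has_real_derivative u1 t) (at t)" "(v has_real_derivative v1 t) (at t)"
    and pos: "0 < (u t)^2 + (v t)^2"
  shows "((\<lambda>t. sqrt ((u t)^2 + (v t)^2)) has_real_derivative
      (u t * u1 t + v t * v1 t) / sqrt ((u t)^2 + (v t)^2)) (at t)"
proof -
  have "((\<lambda>t. (u t)^2 + (v t)^2) has_real_derivative 2 * (u t * u1 t + v t * v1 t)) (at t)"
    by (auto intro!: derivative_eq_intros assms(1,2))
  from DERIV_chain2[OF DERIV_real_sqrt[OF pos] this]
  have "((\<lambda>t. sqrt ((u t)^2 + (v t)^2)) has_real_derivative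
      inverse (sqrt ((u t)^2 + (v t)^2)) / 2 * (2 * (u t * u1 t + v t * v1 t))) (at t)" .
  moreover have "inverse q / 2 * (2 * z) = z / q" for q z :: real
    by (cases "q = 0") (simp_all add: field_simps)
  ultimately show ?thesis by (simp only:)
qed

text \<open>The quotient rule yields squared speed minus squared radial velocity, which Lagrange's
  identity turns into the squared tangential velocity. This is how \<omega> and \<psi>
  arise.\<close>

lemma has_real_derivative_norm2':
  fixes u v u1 v1 :: "real \<Rightarrow> real"
  assumes d: "(u has_real_derivative u1 t) (at t)" "(v has_real_derivative v1 t) (at t)"
     "(u1 has_real_derivative u2) (at t)" "(v1 has_real_derivative v2) (at t)"
    and pos: "0 < (u t)^2 + (v t)^2"
  shows "((\<lambda>t. (u t * u1 t + v t * v1 t) / sqrt ((u t)^2 + (v t)^2)) has_real_derivative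
      (((u t * v1 t - v t * u1 t) / sqrt ((u t)^2 + (v t)^2))^2 + (u t * u2 + v t * v2)) / sqrt ((u t)^2 + (v t)^2)) (at t)"
proof -
  define q where "q = sqrt ((u t)^2 + (v t)^2)"
  have q: "q > 0" "q^2 = (u t)^2 + (v t)^2" using pos by (simp_all add: q_def)
  have "((\<lambda>t. (u t * u1 t + v t * v1 t) / sqrt ((u t)^2 + (v t)^2)) has_real_derivative
     (((u1 t * u1 t + u t * u2) + (v1 t * v1 t + v t * v2)) * q
       - (u t * u1 t + v t * v1 t) * ((u t * u1 t + v t * v1 t) / q)) / (q * q)) (at t)"
    unfolding q_def
    by (intro DERIV_divide DERIV_cong[OF DERIV_add[OF DERIV_mult[OF d(1,3)] DERIV_mult[OF d(2,4)]]]
        has_real_derivative_norm2 d pos) (use pos in \<open>auto simp: algebra_simps\<close>)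
  moreover have "(((u1 t * u1 t + u t * u2) + (v1 t * v1 t + v t * v2)) * q
       - (u t * u1 t + v t * v1 t) * ((u t * u1 t + v t * v1 t) / q)) / (q * q)
     = ((u1 t)^2 + (v1 t)^2 + (u t * u2 + v t * v2) - ((u t * u1 t + v t * v1 t) / q)^2) / q"
    using q(1) by (simp add: field_simps power2_eq_square)
  ultimately show ?thesis
    using lagrange_identity_quotient[of q "u t" "v t" "u1 t" "v1 t"] q unfolding q_def[symmetric] by (simp add: add_ac)
qed

text \<open>The fundamental theorem of calculus tolerates finitely many exceptional points of a
  continuous function. They will be the parameters at which the determinant vanishes.\<close>

lemma nondecreasing_if_derivative_nonneg_off_finite:
  fixes f f' :: "real \<Rightarrow> real"
  assumes "finite S" "a \<le> b" "continuous_on {a..b} f"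
    and d: "\<And>x. x \<in> {a..b} - S \<Longrightarrow> (f has_real_derivative f' x) (at x) \<and> 0 \<le> f' x"
  shows "f a \<le> f b"
proof -
  define g where "g x = (if x \<in> S then 0 else f' x)" for x
  have "(g has_integral (f b - f a)) {a..b}"
    using assms by (intro fundamental_theorem_of_calculus_strong[of S])
      (auto simp: g_def has_real_derivative_iff_has_vector_derivative)
  then have "0 \<le> f b - f a" by (rule has_integral_nonneg) (use d in \<open>auto simp: g_def\<close>)
  then show ?thesis by simp
qed

text \<open>
  For \<open>ad < bc\<close> the smaller singular value is \<open>(Q - P)/2\<close>. Keeping the sign of \<open>(P - Q)/2\<close> makes \<open>P\<close>, \<open>Q\<close> smooth for
  positive entries, so that the sum is continuously differentiable even where \<open>ad = bc\<close>.
\<close>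

definition sv_sum :: "real \<Rightarrow> real \<Rightarrow> real \<Rightarrow> real \<Rightarrow> real \<Rightarrow> real" where
  "sv_sum p a b c d = (let P = sqrt ((a+d)^2+(c-b)^2); Q = sqrt ((a-d)^2+(b+c)^2)
     in ((P+Q)/2) powr p + \<bar>(P-Q)/2\<bar> powr p)"

definition sv_sum_deriv ::
    "real \<Rightarrow> real \<Rightarrow> real \<Rightarrow> real \<Rightarrow> real \<Rightarrow> real \<Rightarrow> real \<Rightarrow> real \<Rightarrow> real \<Rightarrow> real" where
  "sv_sum_deriv p a b c d a' b' c' d' =
    (let P = sqrt ((a+d)^2+(c-b)^2); Q = sqrt ((a-d)^2+(b+c)^2);
         P' = ((a+d)*(a'+d')+(c-b)*(c'-b'))/P; Q' = ((a-d)*(a'-d')+(b+c)*(b'+c'))/Q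
     in p * (((P+Q)/2) powr (p-1) * ((P'+Q')/2) + sgn ((P-Q)/2) * \<bar>(P-Q)/2\<bar> powr (p-1) * ((P'-Q')/2)))"

text \<open>Exchanging the columns swaps \<open>P\<close> and \<open>Q\<close> and reverses the sign
  of the determinant, which reduces the case \<open>ad < bc\<close> to
  \<open>ad > bc\<close>.\<close>

lemma sv_sum_deriv_swap:
  "sv_sum_deriv p a b c d a' b' c' d' = sv_sum_deriv p b a d c b' a' d' c'"
proof -
  define P Q P' Q' where "P = sqrt ((a+d)^2+(c-b)^2)" "Q = sqrt ((a-d)^2+(b+c)^2)"
    "P' = ((a+d)*(a'+d')+(c-b)*(c'-b'))/P" "Q' = ((a-d)*(a'-d')+(b+c)*(b'+c'))/Q"
  note PQ = this
  have "sqrt ((b+c)^2+(d-a)^2) = Q" "sqrt ((b-c)^2+(a+d)^2) = P"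
    unfolding PQ by (simp_all add: power2_commute add.commute)
  moreover have "((b+c)*(b'+c')+(d-a)*(d'-a'))/Q = Q'" "((b-c)*(b'-c')+(a+d)*(a'+d'))/P = P'"
    unfolding PQ(3,4) by (simp_all add: algebra_simps)
  moreover have "sgn ((Q-P)/2) * \<bar>(Q-P)/2\<bar> powr (p-1) * ((Q'-P')/2)
      = sgn ((P-Q)/2) * \<bar>(P-Q)/2\<bar> powr (p-1) * ((P'-Q')/2)"
    by (cases P Q rule: linorder_cases) (simp_all add: field_simps)
  ultimately show ?thesis unfolding sv_sum_deriv_def Let_def PQ[symmetric]
    by (simp add: add.commute)
qed

text \<open>Positive entries keep both plane vectors away from 0, so their lengths are smooth; a
  zero of \<open>P - Q\<close> is harmless by \<open>has_real_derivative_abs_powr\<close>.\<close>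

lemma has_real_derivative_sv_sum:
  assumes d: "(a has_real_derivative a') (at t)" "(b has_real_derivative b') (at t)"
    "(c has_real_derivative c') (at t)" "(d has_real_derivative d') (at t)"
    and pos: "a t > 0" "b t > 0" "c t > 0" "d t > 0" and p: "p > 1"
  shows "((\<lambda>t. sv_sum p (a t) (b t) (c t) (d t)) has_real_derivative
     sv_sum_deriv p (a t) (b t) (c t) (d t) a' b' c' d') (at t)"
proof -
  have P0: "0 < (a t + d t)^2+(c t - b t)^2" and Q0: "0 < (a t - d t)^2+(b t + c t)^2"
    using pos by (simp_all add: add_pos_nonneg add_nonneg_pos)
  define P Q where "P t = sqrt ((a t + d t)^2+(c t - b t)^2)" "Q t = sqrt ((a t - d t)^2+(b t + c t)^2)" for t
  note PQ = this
  define P' Q' where "P' = ((a t + d t)*(a'+d')+(c t - b t)*(c'-b'))/P t"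
    "Q' = ((a t - d t)*(a'-d')+(b t + c t)*(b'+c'))/Q t"
  have dP: "(P has_real_derivative P') (at t)" unfolding PQ P'_Q'_def
    using d P0 by (intro has_real_derivative_norm2 derivative_intros) auto
  have dQ: "(Q has_real_derivative Q') (at t)" unfolding PQ P'_Q'_def
    using d Q0 by (intro has_real_derivative_norm2 derivative_intros) auto
  have PQ0: "P t > 0" "Q t > 0" using P0 Q0 by (simp_all add: PQ)
  have ds: "((\<lambda>t. (P t + Q t)/2) has_real_derivative (P'+Q')/2) (at t)"
    and dr: "((\<lambda>t. (P t - Q t)/2) has_real_derivative (P'-Q')/2) (at t)"
    by (rule DERIV_cdivide[OF DERIV_add[OF dP dQ]], rule DERIV_cdivide[OF DERIV_diff[OF dP dQ]])
  have "((\<lambda>t. ((P t + Q t)/2) powr p + \<bar>(P t - Q t)/2\<bar> powr p) has_real_derivative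
     (p * ((P t + Q t)/2) powr (p-1)) * ((P'+Q')/2)
     + (p * (sgn ((P t - Q t)/2) * \<bar>(P t - Q t)/2\<bar> powr (p-1))) * ((P'-Q')/2)) (at t)"
    using PQ0 by (intro DERIV_add DERIV_chain2[OF has_real_derivative_powr ds]
        DERIV_chain2[OF has_real_derivative_abs_powr[OF p] dr]) auto
  then show ?thesis unfolding sv_sum_def sv_sum_deriv_def Let_def PQ[symmetric] P'_Q'_def[symmetric]
    by (simp add: algebra_simps)
qed

text \<open>The equations \<open>t' = -p t^2\<close> for the logarithmic derivatives are those of
  entries whose \<open>p\<close>-th powers move along a straight line.
  \<open>hessian_identity\<close> then leaves three squares, and their coefficients are nonnegative
  after multiplication by \<open>2-p\<close>.\<close>

lemma sv_sum_second_deriv: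
  fixes a b c d ta tb tc td :: "real \<Rightarrow> real"
  assumes pos: "a t > 0" "b t > 0" "c t > 0" "d t > 0" and p: "p > 1" and D: "b t * c t < a t * d t"
    and da: "(a has_real_derivative a t * ta t) (at t)" "(b has_real_derivative b t * tb t) (at t)"
    "(c has_real_derivative c t * tc t) (at t)" "(d has_real_derivative d t * td t) (at t)"
    and d2: "(ta has_real_derivative - p * (ta t)^2) (at t)" "(tb has_real_derivative - p * (tb t)^2) (at t)"
    "(tc has_real_derivative - p * (tc t)^2) (at t)" "(td has_real_derivative - p * (td t)^2) (at t)"
  shows "\<exists>E. ((\<lambda>t. sv_sum_deriv p (a t) (b t) (c t) (d t) (a t * ta t) (b t * tb t) (c t * tc t) (d t * td t))
     has_real_derivative E) (at t) \<and> 0 \<le> (2-p) * E"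
proof -
  have P0: "0 < (a t + d t)^2+(c t - b t)^2" and Q0: "0 < (a t - d t)^2+(b t + c t)^2"
    using pos by (simp_all add: add_pos_nonneg add_nonneg_pos)
  define P Q where "P t = sqrt ((a t + d t)^2+(c t - b t)^2)" "Q t = sqrt ((a t - d t)^2+(b t + c t)^2)" for t
  note PQ = this
  define P' where "P' t = ((a t + d t)*(a t * ta t+d t * td t)+(c t - b t)*(c t * tc t-b t * tb t))/P t" for t
  define Q' where "Q' t = ((a t - d t)*(a t * ta t-d t * td t)+(b t + c t)*(b t * tb t+c t * tc t))/Q t" for t
  define \<omega> where "\<omega> = ((a t + d t)*(c t * tc t-b t * tb t)-(c t - b t)*(a t * ta t+d t * td t))/P t"
  define \<psi> where "\<psi> = ((a t - d t)*(b t * tb t+c t * tc t)-(b t + c t)*(a t * ta t-d t * td t))/Q t"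
  define P2 where "P2 = (\<omega>^2 + (1-p)*((a t+d t)*(a t*(ta t)^2+d t*(td t)^2)+(c t-b t)*(c t*(tc t)^2-b t*(tb t)^2))) / P t"
  define Q2 where "Q2 = (\<psi>^2 + (1-p)*((a t-d t)*(a t*(ta t)^2-d t*(td t)^2)+(b t+c t)*(b t*(tb t)^2+c t*(tc t)^2))) / Q t"
  have da2: "((\<lambda>t. a t * ta t) has_real_derivative (1-p)*(a t * (ta t)^2)) (at t)"
    "((\<lambda>t. b t * tb t) has_real_derivative (1-p)*(b t * (tb t)^2)) (at t)"
    "((\<lambda>t. c t * tc t) has_real_derivative (1-p)*(c t * (tc t)^2)) (at t)"
    "((\<lambda>t. d t * td t) has_real_derivative (1-p)*(d t * (td t)^2)) (at t)"
    using da d2 by (auto intro!: derivative_eq_intros simp: algebra_simps power2_eq_square)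
  have dP: "(P has_real_derivative P' t) (at t)" unfolding PQ P'_def
    using da P0 by (intro has_real_derivative_norm2 derivative_intros) auto
  have dQ: "(Q has_real_derivative Q' t) (at t)" unfolding PQ Q'_def
    using da Q0 by (intro has_real_derivative_norm2 derivative_intros) auto
  have dP': "(P' has_real_derivative P2) (at t)" unfolding PQ P'_def
    by (rule DERIV_cong[OF has_real_derivative_norm2'[OF DERIV_add[OF da(1,4)] DERIV_diff[OF da(3,2)]
        DERIV_add[OF da2(1,4)] DERIV_diff[OF da2(3,2)] P0]])
      (simp add: P2_def \<omega>_def PQ algebra_simps)
  have dQ': "(Q' has_real_derivative Q2) (at t)" unfolding PQ Q'_def
    by (rule DERIV_cong[OF has_real_derivative_norm2'[OF DERIV_diff[OF da(1,4)] DERIV_add[OF da(2,3)]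
        DERIV_diff[OF da2(1,4)] DERIV_add[OF da2(2,3)] Q0]])
      (simp add: Q2_def \<psi>_def PQ algebra_simps)
  define s r where "s = (P t + Q t)/2" "r = (P t - Q t)/2"
  have PQs: "P t = s + r" "Q t = s - r" by (simp_all add: s_r_def field_simps)
  have PQ0: "P t > 0" "Q t > 0" using P0 Q0 by (simp_all add: PQ)
  have sq: "(P t)^2 = (a t + d t)^2+(c t - b t)^2" "(Q t)^2 = (a t - d t)^2+(b t + c t)^2"
    by (simp_all add: PQ)
  \<comment> \<open>A positive determinant gives \<open>Q t < P t\<close>, hence
    \<open>r > 0\<close>, where the signed power is an ordinary power.\<close>
  have "(P t)^2 - (Q t)^2 = 4 * (a t * d t - b t * c t)"
    unfolding sq by (simp add: algebra_simps power2_eq_square)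
  with D have "0 < (P t)^2 - (Q t)^2" by simp
  then have "(Q t)^2 < (P t)^2" by simp
  then have "Q t < P t" using PQ0 power2_less_imp_less by force
  then have sr: "s > 0" "r > 0" "s > r" using PQ0 by (simp_all add: s_r_def)
  have ds: "((\<lambda>t. (P t + Q t)/2) has_real_derivative (P' t+Q' t)/2) (at t)"
    and dr: "((\<lambda>t. (P t - Q t)/2) has_real_derivative (P' t-Q' t)/2) (at t)"
    and ds': "((\<lambda>t. (P' t + Q' t)/2) has_real_derivative (P2+Q2)/2) (at t)"
    and dr': "((\<lambda>t. (P' t - Q' t)/2) has_real_derivative (P2-Q2)/2) (at t)"
    by (rule DERIV_cdivide[OF DERIV_add[OF dP dQ]], rule DERIV_cdivide[OF DERIV_diff[OF dP dQ]],
      rule DERIV_cdivide[OF DERIV_add[OF dP' dQ']], rule DERIV_cdivide[OF DERIV_diff[OF dP' dQ']])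
  define E where "E = p * ((p-1)*(s powr (p-1) / s * ((P' t+Q' t)/2)^2 + r powr (p-1) / r * ((P' t-Q' t)/2)^2)
     + s powr (p-1) * ((P2+Q2)/2) + r powr (p-1) * ((P2-Q2)/2))"
  have pw: "x powr (p-1-1) = x powr (p-1) / x" if "x > 0" for x :: real
    using that by (simp add: powr_diff power2_eq_square)
  have "((\<lambda>t. p * (((P t+Q t)/2) powr (p-1) * ((P' t+Q' t)/2)
      + sgn ((P t-Q t)/2) * \<bar>(P t-Q t)/2\<bar> powr (p-1) * ((P' t-Q' t)/2))) has_real_derivative
     p * (((p-1) * ((P t+Q t)/2) powr (p-1-1)) * ((P' t+Q' t)/2) * ((P' t+Q' t)/2)
           + (P2+Q2)/2 * ((P t+Q t)/2) powr (p-1)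
       + (((p-1) * ((P t-Q t)/2) powr (p-1-1)) * ((P' t-Q' t)/2) * ((P' t-Q' t)/2)
           + (P2-Q2)/2 * (sgn ((P t-Q t)/2) * \<bar>(P t-Q t)/2\<bar> powr (p-1))))) (at t)"
    using sr unfolding s_r_def
    by (intro DERIV_cmult DERIV_add DERIV_mult ds' dr' DERIV_chain2[OF has_real_derivative_powr ds]
        DERIV_chain2[OF has_real_derivative_sgn_powr dr]) auto
  also have "p * (((p-1) * ((P t+Q t)/2) powr (p-1-1)) * ((P' t+Q' t)/2) * ((P' t+Q' t)/2)
           + (P2+Q2)/2 * ((P t+Q t)/2) powr (p-1)
       + (((p-1) * ((P t-Q t)/2) powr (p-1-1)) * ((P' t-Q' t)/2) * ((P' t-Q' t)/2)
           + (P2-Q2)/2 * (sgn ((P t-Q t)/2) * \<bar>(P t-Q t)/2\<bar> powr (p-1)))) = E"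
  proof -
    have "p * (((p-1)*A)*x*x + z*S + (((p-1)*B)*y*y + w*(1*R))) = p * ((p-1)*(A*x^2+B*y^2) + S*z + R*w)"
      for A B R S w x y z by (simp add: algebra_simps power2_eq_square)
    moreover have "sgn r = 1" "\<bar>r\<bar> = r" using sr by simp_all
    ultimately show ?thesis unfolding s_r_def[symmetric] pw[OF sr(1)] pw[OF sr(2)] E_def by (simp only:)
  qed
  finally have "((\<lambda>t. sv_sum_deriv p (a t) (b t) (c t) (d t) (a t * ta t) (b t * tb t) (c t * tc t) (d t * td t))
     has_real_derivative E) (at t)"
    unfolding sv_sum_deriv_def Let_def PQ[symmetric] P'_def[symmetric] Q'_def[symmetric] .
  moreover have "0 \<le> (2-p) * E"
  proof -
    define S R where "S = s powr (p-1)" "R = r powr (p-1)"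
    define Y where "Y = (s*R-r*S) / (s^2-r^2)"
    define \<epsilon> where "\<epsilon> = a t*b t*c t*d t/(s*r)*(ta t+td t-tb t-tc t)^2"
    have \<epsilon>: "\<epsilon> \<ge> 0" using pos sr by (simp add: \<epsilon>_def)
    have Eeq: "E = p * ((p-1)*Y*(\<omega>^2-\<psi>^2+\<epsilon>)
       + (2-p)/2*((S+R)/(s+r)*\<omega>^2 + (S-R)/(s-r)*\<psi>^2))"
      unfolding E_def S_R_def[symmetric] add.assoc[symmetric] \<epsilon>_def
      by (subst hessian_identity[OF pos sr sq[unfolded PQs] \<omega>_def[unfolded PQs] \<psi>_def[unfolded PQs]
          P'_def[of t, unfolded PQs] Q'_def[of t, unfolded PQs] P2_def[unfolded PQs] Q2_def[unfolded PQs] Y_def]) simp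
    have den: "s^2-r^2 = (s-r)*(s+r)" "s-r > 0" "s+r > 0" using sr by (simp_all add: algebra_simps power2_eq_square)
    \<comment> \<open>Apart from the overall factor \<open>p\<close>, the coefficient of \<epsilon>
      is \<open>p-1\<close> times this quantity, that of \<open>\<psi>^2\<close> is the one in
      \<open>c1\<close>, and that of \<open>\<omega>^2\<close> is the coefficient of \<epsilon> plus
      the quantity in \<open>c2\<close>.\<close>
    have Y: "0 \<le> (2-p)*Y" using powr_difference_ineqs(1)[OF sr(2,3) p] den
      unfolding Y_def S_R_def times_divide_eq_right by simp
    have c1: "0 \<le> (2-p)*((2-p)/2*((S-R)/(s-r)) - (p-1)*Y)"
    proof -
      have "x*(h*(A/U) - k*(N/(U*V))) = (x*(h*A*V - k*N))/(U*V)" if "U > 0" "V > 0" for x h A U k N V :: real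
        using that by (simp add: field_simps)
      from this[OF den(2,3)] have "(2-p)*((2-p)/2*((S-R)/(s-r)) - (p-1)*Y)
         = ((2-p)*((2-p)/2*(S-R)*(s+r) - (p-1)*(s*R-r*S))) / (s^2-r^2)"
        unfolding Y_def den(1) .
      then show ?thesis using powr_difference_ineqs(2)[OF sr(2,3) p] den unfolding S_R_def by simp
    qed
    have "0 \<le> (2-p)^2/2" by simp
    then have "0 \<le> (2-p)*((2-p)/2)" by (simp add: power2_eq_square)
    moreover have "0 \<le> (S+R)/(s+r)" using den by (simp add: S_R_def)
    ultimately have c2: "0 \<le> (2-p)*((2-p)/2)*((S+R)/(s+r))" by (rule mult_nonneg_nonneg)
    have "z*(p*(k*Y*(w-x+\<epsilon>) + h*(B*w + A*x)))
        = p*((k*(z*Y) + z*h*B)*w + z*(h*A - k*Y)*x + k*(z*Y)*\<epsilon>)" for z k w x h A B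
      by (simp add: algebra_simps)
    then have "(2-p)*E = p * (((p-1)*((2-p)*Y) + (2-p)*((2-p)/2)*((S+R)/(s+r)))*\<omega>^2
       + (2-p)*((2-p)/2*((S-R)/(s-r)) - (p-1)*Y)*\<psi>^2 + (p-1)*((2-p)*Y)*\<epsilon>)"
      unfolding Eeq .
    also have "\<dots> \<ge> 0"
      using p by (intro mult_nonneg_nonneg[OF _ add_nonneg_nonneg] add_nonneg_nonneg[OF mult_nonneg_nonneg mult_nonneg_nonneg]
        mult_nonneg_nonneg[OF _ \<epsilon>] mult_nonneg_nonneg[OF _ Y] add_nonneg_nonneg[OF _ c2] c1) auto
    finally show ?thesis .
  qed
  ultimately show ?thesis by blast
qed

section \<open>Convexity in the powers of the entries\<close>

text \<open>The arguments are the \<open>p\<close>-th powers of the entries, the coordinates in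
  which the sum is homogeneous of degree one and turns out convex or concave.\<close>

definition sv_sum_powr :: "real \<Rightarrow> real \<Rightarrow> real \<Rightarrow> real \<Rightarrow> real \<Rightarrow> real" where
  "sv_sum_powr p z1 z2 z3 z4 = sv_sum p (z1 powr (1/p)) (z2 powr (1/p)) (z3 powr (1/p)) (z4 powr (1/p))"

lemma sv_sum_scale:
  assumes "k \<ge> 0"
  shows "sv_sum p (k*a) (k*b) (k*c) (k*d) = k powr p * sv_sum p a b c d"
proof -
  have s: "sqrt ((k*x)^2+(k*y)^2) = k * sqrt (x^2+y^2)" for x y
    using assms by (simp add: power_mult_distrib distrib_left[symmetric] real_sqrt_mult)
  have e: "k*a+k*d = k*(a+d)" "k*c-k*b = k*(c-b)" "k*a-k*d = k*(a-d)" "k*b+k*c = k*(b+c)"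
    by (simp_all add: algebra_simps)
  define P Q where PQ: "P = sqrt ((a+d)^2+(c-b)^2)" "Q = sqrt ((a-d)^2+(b+c)^2)"
  have PQ0: "P \<ge> 0" "Q \<ge> 0" by (simp_all add: PQ)
  have h: "(k*P+k*Q)/2 = k*((P+Q)/2)" "\<bar>(k*P-k*Q)/2\<bar> = k*\<bar>(P-Q)/2\<bar>"
    using assms by (simp_all add: distrib_left abs_mult right_diff_distrib[symmetric])
  have "(k*x) powr p = k powr p * x powr p" if "x \<ge> 0" for x
    using assms that by (simp add: powr_mult)
  from this[of "(P+Q)/2"] this[of "\<bar>(P-Q)/2\<bar>"] PQ0
  have "(k*((P+Q)/2)) powr p + (k*\<bar>(P-Q)/2\<bar>) powr p = k powr p * (((P+Q)/2) powr p + \<bar>(P-Q)/2\<bar> powr p)"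
    unfolding distrib_left by simp
  then show ?thesis unfolding sv_sum_def Let_def e s PQ[symmetric] h .
qed

lemma continuous_on_sv_sum:
  fixes a b c d :: "real \<Rightarrow> real"
  assumes "continuous_on S a" "continuous_on S b" "continuous_on S c" "continuous_on S d" "p > 0"
  shows "continuous_on S (\<lambda>t. sv_sum p (a t) (b t) (c t) (d t))"
  unfolding sv_sum_def Let_def using assms
  by (intro continuous_intros continuous_on_powr') (auto simp: add_nonneg_nonneg)

lemma finite_quadratic_roots:
  fixes c0 c1 c2 :: real assumes "c0 \<noteq> 0 \<or> c2 \<noteq> 0"
  shows "finite {t. c0 + t * (c1 + t * c2) = 0}"
proof -
  have "[:c0, c1, c2:] \<noteq> 0" using assms by auto
  from poly_roots_finite[OF this] show ?thesis by (simp add: mult.commute)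
qed

text \<open>Along the segment, \<open>2-p\<close> times the derivative is continuous, and it is
  nondecreasing because its own derivative is nonnegative wherever the determinant is nonzero. By
  \<open>nd\<close> the exceptions are finite in number. The resulting convexity is evaluated at the
  midpoint.\<close>

lemma sv_sum_powr_midpoint:
  fixes x1 x2 x3 x4 y1 y2 y3 y4 :: real
  assumes p: "p > 1" and pos: "x1 > 0" "x2 > 0" "x3 > 0" "x4 > 0" "y1 > 0" "y2 > 0" "y3 > 0" "y4 > 0"
    and nd: "x1*x4 \<noteq> x2*x3"
  shows "(2-p) * sv_sum_powr p ((x1+y1)/2) ((x2+y2)/2) ((x3+y3)/2) ((x4+y4)/2)
     \<le> (2-p) * (sv_sum_powr p x1 x2 x3 x4 + sv_sum_powr p y1 y2 y3 y4) / 2"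
proof -
  \<comment> \<open>\<open>l\<close> is the affine path of a \<open>p\<close>-th power,
    \<open>m\<close> the entry itself and \<open>q\<close> the logarithmic derivative of
    \<open>m\<close>.\<close>
  define l where "l x y t = x + t*(y-x)" for x y t :: real
  define m where "m x y t = l x y t powr (1/p)" for x y t
  define q where "q x y t = (y-x) / (p * l x y t)" for x y t
  have l0: "l x y t > 0" if "x > 0" "y > 0" "t \<in> {0..1}" for x y t
  proof -
    have "l x y t = (1-t)*x + t*y" by (simp add: l_def algebra_simps)
    moreover have "(1-t)*x + t*y > 0" using that
      by (cases "t = 0") (auto intro!: add_nonneg_pos)
    ultimately show ?thesis by simp
  qed
  have m0: "m x y t > 0" if "x > 0" "y > 0" "t \<in> {0..1}" for x y t
    using l0[OF that] by (simp add: m_def)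
  have dl: "(l x y has_real_derivative (y-x)) (at t)" for x y t
    unfolding l_def by (auto intro!: derivative_eq_intros)
  have dm: "(m x y has_real_derivative m x y t * q x y t) (at t)" if "x > 0" "y > 0" "t \<in> {0..1}" for x y t
  proof -
    have "(m x y has_real_derivative (1/p) * l x y t powr (1/p-1) * (y-x)) (at t)"
      unfolding m_def by (rule DERIV_chain2[OF has_real_derivative_powr[OF l0[OF that]] dl])
    then show ?thesis using l0[OF that] p by (simp add: m_def q_def powr_diff)
  qed
  have dq: "(q x y has_real_derivative - p * (q x y t)^2) (at t)" if "x > 0" "y > 0" "t \<in> {0..1}" for x y t
  proof -
    have "(q x y has_real_derivative (0 * (p * l x y t) - (y-x) * (p * (y-x))) / ((p * l x y t) * (p * l x y t))) (at t)"
      unfolding q_def using l0[OF that] p by (intro DERIV_divide DERIV_cmult dl DERIV_const) auto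
    then show ?thesis using l0[OF that] p by (simp add: q_def power2_eq_square)
  qed
  define f where "f t = sv_sum p (m x1 y1 t) (m x2 y2 t) (m x3 y3 t) (m x4 y4 t)" for t
  define f' where "f' t = sv_sum_deriv p (m x1 y1 t) (m x2 y2 t) (m x3 y3 t) (m x4 y4 t)
      (m x1 y1 t * q x1 y1 t) (m x2 y2 t * q x2 y2 t) (m x3 y3 t * q x3 y3 t) (m x4 y4 t * q x4 y4 t)" for t
  have df: "(f has_real_derivative f' t) (at t)" if t: "t \<in> {0..1}" for t
    unfolding f_def f'_def by (intro has_real_derivative_sv_sum dm m0 pos t p)
  \<comment> \<open>The zeros of the determinant along the segment, tested on the
    \<open>p\<close>-th powers since taking roots preserves the comparison of products. The
    difference is quadratic in \<open>t\<close> and nonzero at \<open>t = 0\<close> by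
    \<open>nd\<close>.\<close>
  define S where "S = {t. l x1 y1 t * l x4 y4 t = l x2 y2 t * l x3 y3 t}"
  have "S = {t. (x1*x4 - x2*x3) + t * ((x1*(y4-x4)+x4*(y1-x1)-x2*(y3-x3)-x3*(y2-x2))
      + t * ((y1-x1)*(y4-x4)-(y2-x2)*(y3-x3))) = 0}"
    unfolding S_def l_def by (auto simp: algebra_simps)
  then have S: "finite S" using nd by (simp only:) (intro finite_quadratic_roots, simp)
  have d2: "\<exists>E. (f' has_real_derivative E) (at t) \<and> 0 \<le> (2-p)*E" if t: "t \<in> {0..1} - S" for t
  proof -
    have t1: "t \<in> {0..1}" using t by simp
    have mm: "m x y t * m x' y' t = (l x y t * l x' y' t) powr (1/p)"
      if "x > 0" "y > 0" "x' > 0" "y' > 0" for x y x' y'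
      using l0[OF that(1,2) t1] l0[OF that(3,4) t1] by (simp add: m_def powr_mult)
    have lt: "m x y t * m x' y' t < m w z t * m w' z' t"
      if "x > 0" "y > 0" "x' > 0" "y' > 0" "w > 0" "z > 0" "w' > 0" "z' > 0"
        "l x y t * l x' y' t < l w z t * l w' z' t" for x y x' y' w z w' z'
      unfolding mm[OF that(1-4)] mm[OF that(5-8)]
      using p l0[OF that(1,2) t1] l0[OF that(3,4) t1] that(9) by (intro powr_less_mono2) auto
    from t consider "l x2 y2 t * l x3 y3 t < l x1 y1 t * l x4 y4 t" | "l x1 y1 t * l x4 y4 t < l x2 y2 t * l x3 y3 t"
      unfolding S_def by force
    then show ?thesis
    proof cases
      case 1
      show ?thesis unfolding f'_def
        by (rule sv_sum_second_deriv) (intro m0 dm dq pos t1 p lt 1)+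
    next
      case 2
      show ?thesis unfolding f'_def
        by (subst sv_sum_deriv_swap, rule sv_sum_second_deriv) (intro m0 dm dq pos t1 p lt 2)+
    qed
  qed
  define E where "E t = (SOME E. (f' has_real_derivative E) (at t) \<and> 0 \<le> (2-p)*E)" for t
  have E: "(f' has_real_derivative E t) (at t)" "0 \<le> (2-p)*E t" if "t \<in> {0..1} - S" for t
    using someI_ex[OF d2[OF that]] unfolding E_def by auto
  have cm: "continuous_on {0..1} (m x y)" "continuous_on {0..1} (q x y)" if "x > 0" "y > 0" for x y
    using dm[OF that] dq[OF that] by (meson DERIV_isCont continuous_at_imp_continuous_on)+
  define P Q where "P t = sqrt ((m x1 y1 t + m x4 y4 t)^2 + (m x3 y3 t - m x2 y2 t)^2)"
    "Q t = sqrt ((m x1 y1 t - m x4 y4 t)^2 + (m x2 y2 t + m x3 y3 t)^2)" for t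
  note PQ = this
  have PQ0: "\<forall>t\<in>{0..1}. P t \<noteq> 0" "\<forall>t\<in>{0..1}. Q t \<noteq> 0"
  proof safe
    fix t :: real assume t: "t \<in> {0..1}"
    note gt = m0[OF pos(1,5) t] m0[OF pos(2,6) t] m0[OF pos(3,7) t] m0[OF pos(4,8) t]
    show False if "P t = 0" using that gt by (simp add: PQ sum_power2_eq_zero_iff)
    show False if "Q t = 0" using that gt by (simp add: PQ sum_power2_eq_zero_iff)
  qed
  have cPQ: "continuous_on {0..1} P" "continuous_on {0..1} Q"
    unfolding PQ by (intro continuous_intros cm pos)+
  have cf': "continuous_on {0..1} f'"
  proof -
    have "P t + Q t > 0" if "t \<in> {0..1}" for t
    proof -
      have "P t \<ge> 0" "Q t \<ge> 0" by (simp_all add: PQ)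
      moreover have "P t \<noteq> 0" using PQ0(1) that by blast
      ultimately show ?thesis by linarith
    qed
    then have "\<forall>t\<in>{0..1}. (P t + Q t)/2 \<noteq> 0" by force
    then show ?thesis
      unfolding f'_def sv_sum_deriv_def Let_def PQ[symmetric]
      using p by (intro continuous_on_mult continuous_on_add continuous_on_diff continuous_on_divide
          continuous_on_const continuous_on_powr continuous_on_sgn_powr cm pos cPQ PQ0) auto
  qed
  have mono: "(2-p) * f' x \<le> (2-p) * f' y" if "x \<in> {0..1}" "y \<in> {0..1}" "x \<le> y" for x y
  proof (rule nondecreasing_if_derivative_nonneg_off_finite[where f = "\<lambda>t. (2-p) * f' t" and f' = "\<lambda>t. (2-p) * E t" and S = S])
    show "continuous_on {x..y} (\<lambda>t. (2-p) * f' t)"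
      using that by (intro continuous_intros continuous_on_subset[OF cf']) auto
    show "((\<lambda>t. (2-p) * f' t) has_real_derivative (2-p) * E t) (at t) \<and> 0 \<le> (2-p) * E t"
      if "t \<in> {x..y} - S" for t
      using E[of t] that \<open>x \<in> {0..1}\<close> \<open>y \<in> {0..1}\<close> by (auto intro!: DERIV_cmult)
  qed (use S that in auto)
  have "convex_on {0..1} (\<lambda>t. (2-p) * f t)"
    by (rule convex_on_realI[where f' = "\<lambda>t. (2-p) * f' t"]) (use df mono in \<open>auto intro!: DERIV_cmult\<close>)
  from convex_onD[OF this, of "1/2" 0 1]
  have "(2-p) * f (1/2) \<le> (2-p) * (f 0 + f 1) / 2" by (simp add: field_simps)
  moreover have "f 0 = sv_sum_powr p x1 x2 x3 x4" "f 1 = sv_sum_powr p y1 y2 y3 y4"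
    by (simp_all add: f_def sv_sum_powr_def m_def l_def)
  moreover have "l x y (1/2) = (x+y)/2" for x y by (simp add: l_def field_simps)
  then have "f (1/2) = sv_sum_powr p ((x1+y1)/2) ((x2+y2)/2) ((x3+y3)/2) ((x4+y4)/2)"
    by (simp only: f_def sv_sum_powr_def m_def)
  ultimately show ?thesis by simp
qed


text \<open>The midpoint inequality combined with homogeneity: halving the \<open>p\<close>-th
  powers scales the entries by \<open>k\<close>, and \<open>k powr p = 1/2\<close>.\<close>

lemma sv_sum_powr_subadd_pos:
  fixes x1 x2 x3 x4 y1 y2 y3 y4 :: real
  assumes p: "p > 1" and pos: "x1 > 0" "x2 > 0" "x3 > 0" "x4 > 0" "y1 > 0" "y2 > 0" "y3 > 0" "y4 > 0"
    and nd: "x1*x4 \<noteq> x2*x3"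
  shows "(2-p) * sv_sum_powr p (x1+y1) (x2+y2) (x3+y3) (x4+y4) \<le> (2-p) * (sv_sum_powr p x1 x2 x3 x4 + sv_sum_powr p y1 y2 y3 y4)"
proof -
  define k :: real where "k = (1/2) powr (1/p)"
  have k: "k \<ge> 0" "k powr p = 1/2" using p by (simp_all add: k_def powr_powr)
  have z: "(z/2) powr (1/p) = k * z powr (1/p)" for z :: real
  proof -
    have "(z/2) powr (1/p) = ((1/2) * z) powr (1/p)" by simp
    also have "\<dots> = k * z powr (1/p)" unfolding k_def by (subst powr_mult) simp_all
    finally show ?thesis .
  qed
  have half: "sv_sum_powr p (z1/2) (z2/2) (z3/2) (z4/2) = sv_sum_powr p z1 z2 z3 z4 / 2" for z1 z2 z3 z4
    unfolding sv_sum_powr_def z sv_sum_scale[OF k(1)] k(2) by simp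
  show ?thesis using sv_sum_powr_midpoint[OF p pos nd] unfolding half by simp
qed

text \<open>Zero entries and vanishing determinants are limits of the strict case, by continuity of
  both sides from the right.\<close>

lemma sv_sum_powr_subadd_nonneg:
  fixes x1 x2 x3 x4 y1 y2 y3 y4 :: real
  assumes p: "p > 1" and nn: "x1 \<ge> 0" "x2 \<ge> 0" "x3 \<ge> 0" "x4 \<ge> 0" "y1 \<ge> 0" "y2 \<ge> 0" "y3 \<ge> 0" "y4 \<ge> 0"
  shows "(2-p) * sv_sum_powr p (x1+y1) (x2+y2) (x3+y3) (x4+y4) \<le> (2-p) * (sv_sum_powr p x1 x2 x3 x4 + sv_sum_powr p y1 y2 y3 y4)"
proof -
  \<comment> \<open>The last entry gets \<open>2e\<close> so that the perturbed determinant is a nonzero polynomial in \<open>e\<close>.\<close>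
  define F where "F e = (2-p) * (sv_sum_powr p (x1+e) (x2+e) (x3+e) (x4+2*e) + sv_sum_powr p (y1+e) (y2+e) (y3+e) (y4+2*e))
     - (2-p) * sv_sum_powr p (x1+e+(y1+e)) (x2+e+(y2+e)) (x3+e+(y3+e)) (x4+2*e+(y4+2*e))" for e
  have ch: "continuous_on {0..} (\<lambda>e. sv_sum_powr p (z1 e) (z2 e) (z3 e) (z4 e))"
    if "continuous_on {0..} z1" "continuous_on {0..} z2" "continuous_on {0..} z3" "continuous_on {0..} z4"
      "\<And>e. e \<ge> 0 \<Longrightarrow> z1 e \<ge> 0 \<and> z2 e \<ge> 0 \<and> z3 e \<ge> 0 \<and> z4 e \<ge> 0" for z1 z2 z3 z4 :: "real \<Rightarrow> real"
    unfolding sv_sum_powr_def using p that by (intro continuous_on_sv_sum continuous_on_powr' continuous_intros) auto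
  have "continuous_on {0..} F" unfolding F_def using nn
    by (intro continuous_intros ch) auto
  then have "(F \<longlongrightarrow> F 0) (at 0 within {0..})" by (simp add: continuous_on_def)
  then have lim: "(F \<longlongrightarrow> F 0) (at_right 0)" by (rule tendsto_within_subset) auto
  \<comment> \<open>The perturbed determinant expanded in \<open>e\<close>. Its leading coefficient
    \<open>2 - 1 = 1\<close> leaves finitely many roots, which small positive \<open>e\<close>
    avoid.\<close>
  define Z where "Z = {e. (x1*x4 - x2*x3) + e * ((2*x1+x4-x2-x3) + e * 1) = 0}"
  have "finite Z" unfolding Z_def by (rule finite_quadratic_roots) simp
  then have "open (- (Z - {0}))" by (intro open_Compl finite_imp_closed) simp
  then have "eventually (\<lambda>e. e \<in> - (Z - {0})) (nhds 0)" by (intro eventually_nhds_in_open) simp_all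
  then have "eventually (\<lambda>e. e \<notin> Z - {0}) (nhds 0)" by (rule eventually_mono) auto
  then have "eventually (\<lambda>e. e \<notin> Z - {0}) (at_right 0)" by (rule filter_leD[OF at_within_le_nhds])
  moreover have "eventually (\<lambda>e::real. e > 0) (at_right 0)" by (rule eventually_at_right_less)
  ultimately have "eventually (\<lambda>e. 0 \<le> F e) (at_right 0)"
  proof eventually_elim
    case (elim e)
    then have "(x1+e)*(x4+2*e) \<noteq> (x2+e)*(x3+e)" by (auto simp: Z_def algebra_simps)
    then show ?case using sv_sum_powr_subadd_pos[OF p, of "x1+e" "x2+e" "x3+e" "x4+2*e" "y1+e" "y2+e" "y3+e" "y4+2*e"]
      elim nn unfolding F_def sv_sum_powr_def by (simp add: add_nonneg_pos)
  qed
  from tendsto_lowerbound[OF lim this] have "0 \<le> F 0" by simp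
  then show ?thesis by (simp add: F_def)
qed

section \<open>The exponents 1 and 2, and sums of many terms\<close>

text \<open>Half the sum plus half the distance of two numbers is the larger one. At
  \<open>p = 1\<close>, outside the range of the derivative argument, subadditivity thus comes from
  the triangle inequality for two lengths.\<close>

lemma sv_sum_one: "sv_sum 1 a b c d = max (sqrt ((a+d)^2+(c-b)^2)) (sqrt ((a-d)^2+(b+c)^2))"
proof -
  have "((P+Q)/2) powr 1 + \<bar>(P-Q)/2\<bar> powr 1 = max P Q" if "P \<ge> 0" "Q \<ge> 0" for P Q :: real
    using that by (simp add: max_def abs_if field_simps)
  then show ?thesis unfolding sv_sum_def Let_def by simp
qed

text \<open>The squared Hilbert-Schmidt norm is linear in the squared entries, so there is equality
  at \<open>p = 2\<close>, where the factor \<open>2-p\<close> carries no information.\<close>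

lemma sv_sum_two: "sv_sum 2 a b c d = a^2+b^2+c^2+d^2"
proof -
  have "((P+Q)/2) powr 2 + \<bar>(P-Q)/2\<bar> powr 2 = (P^2+Q^2)/2" if "P \<ge> 0" "Q \<ge> 0" for P Q :: real
    using that by (simp add: powr_numeral power_divide) (simp add: power2_eq_square algebra_simps add_divide_distrib diff_divide_distrib)
  then have "sv_sum 2 a b c d = ((sqrt ((a+d)^2+(c-b)^2))^2 + (sqrt ((a-d)^2+(b+c)^2))^2)/2"
    unfolding sv_sum_def Let_def by (simp del: real_sqrt_pow2_iff real_sqrt_pow2)
  also have "\<dots> = ((a+d)^2+(c-b)^2 + ((a-d)^2+(b+c)^2))/2" by simp
  finally show ?thesis by (simp add: power2_eq_square algebra_simps)
qed

lemma sv_sum_powr_subadditive: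
  fixes x1 x2 x3 x4 y1 y2 y3 y4 :: real
  assumes nn: "x1 \<ge> 0" "x2 \<ge> 0" "x3 \<ge> 0" "x4 \<ge> 0" "y1 \<ge> 0" "y2 \<ge> 0" "y3 \<ge> 0" "y4 \<ge> 0"
  shows "1 \<le> p \<Longrightarrow> p \<le> 2 \<Longrightarrow> sv_sum_powr p (x1+y1) (x2+y2) (x3+y3) (x4+y4) \<le> sv_sum_powr p x1 x2 x3 x4 + sv_sum_powr p y1 y2 y3 y4"
    and "2 \<le> p \<Longrightarrow> sv_sum_powr p x1 x2 x3 x4 + sv_sum_powr p y1 y2 y3 y4 \<le> sv_sum_powr p (x1+y1) (x2+y2) (x3+y3) (x4+y4)"
proof -
  have two: "sv_sum_powr 2 (x1+y1) (x2+y2) (x3+y3) (x4+y4) = sv_sum_powr 2 x1 x2 x3 x4 + sv_sum_powr 2 y1 y2 y3 y4"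
    using nn by (simp add: sv_sum_powr_def sv_sum_two powr_half_sqrt)
  have one: "sv_sum_powr 1 (x1+y1) (x2+y2) (x3+y3) (x4+y4) \<le> sv_sum_powr 1 x1 x2 x3 x4 + sv_sum_powr 1 y1 y2 y3 y4"
  proof -
    have "sqrt ((x1+y1+(x4+y4))^2+(x3+y3-(x2+y2))^2) \<le> sqrt ((x1+x4)^2+(x3-x2)^2) + sqrt ((y1+y4)^2+(y3-y2)^2)"
      "sqrt ((x1+y1-(x4+y4))^2+(x2+y2+(x3+y3))^2) \<le> sqrt ((x1-x4)^2+(x2+x3)^2) + sqrt ((y1-y4)^2+(y2+y3)^2)"
      using real_sqrt_sum_squares_triangle_ineq[of "x1+x4" "y1+y4" "x3-x2" "y3-y2"]
        real_sqrt_sum_squares_triangle_ineq[of "x1-x4" "y1-y4" "x2+x3" "y2+y3"] by (simp_all add: algebra_simps)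
    moreover have "max A B \<le> max a1 a2 + max b1 b2" if "A \<le> a1 + b1" "B \<le> a2 + b2" for A B a1 a2 b1 b2 :: real
      using that by linarith
    ultimately show ?thesis using nn by (simp add: sv_sum_powr_def sv_sum_one)
  qed
  note main = sv_sum_powr_subadd_nonneg[OF _ nn]
  show "sv_sum_powr p (x1+y1) (x2+y2) (x3+y3) (x4+y4) \<le> sv_sum_powr p x1 x2 x3 x4 + sv_sum_powr p y1 y2 y3 y4" if "1 \<le> p" "p \<le> 2"
  proof -
    consider "p = 1" | "p = 2" | "1 < p" "p < 2" using \<open>1 \<le> p\<close> \<open>p \<le> 2\<close> by linarith
    then show ?thesis
      using one two main[of p] by cases simp_all
  qed
  show "sv_sum_powr p x1 x2 x3 x4 + sv_sum_powr p y1 y2 y3 y4 \<le> sv_sum_powr p (x1+y1) (x2+y2) (x3+y3) (x4+y4)" if "2 \<le> p"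
  proof (cases "p = 2")
    case False
    then show ?thesis using main[of p] that by simp
  qed (use two in simp)
qed

lemma sv_sum_zero [simp]: "sv_sum p 0 0 0 0 = 0"
  by (simp add: sv_sum_def)

lemma sv_sum_powr_sum:
  fixes x1 x2 x3 x4 :: "nat \<Rightarrow> real"
  assumes nn: "\<And>i. x1 i \<ge> 0" "\<And>i. x2 i \<ge> 0" "\<And>i. x3 i \<ge> 0" "\<And>i. x4 i \<ge> 0"
  shows "1 \<le> p \<Longrightarrow> p \<le> 2 \<Longrightarrow> sv_sum_powr p (\<Sum>i<n. x1 i) (\<Sum>i<n. x2 i) (\<Sum>i<n. x3 i) (\<Sum>i<n. x4 i)
      \<le> (\<Sum>i<n. sv_sum_powr p (x1 i) (x2 i) (x3 i) (x4 i))"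
    and "2 \<le> p \<Longrightarrow> (\<Sum>i<n. sv_sum_powr p (x1 i) (x2 i) (x3 i) (x4 i))
      \<le> sv_sum_powr p (\<Sum>i<n. x1 i) (\<Sum>i<n. x2 i) (\<Sum>i<n. x3 i) (\<Sum>i<n. x4 i)"
proof (induction n)
  case 0
  { case 1 show ?case by (simp add: sv_sum_powr_def) }
  { case 2 show ?case by (simp add: sv_sum_powr_def) }
next
  case (Suc n)
  have s: "(\<Sum>i<n. x1 i) \<ge> 0" "(\<Sum>i<n. x2 i) \<ge> 0" "(\<Sum>i<n. x3 i) \<ge> 0" "(\<Sum>i<n. x4 i) \<ge> 0"
    using nn by (auto intro: sum_nonneg)
  note le = sv_sum_powr_subadditive[OF s nn[of n]]
  { case 1 then show ?case using Suc.IH(1) le(1)[of p] by force }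
  { case 2 then show ?case using Suc.IH(2) le(2)[of p] by force }
qed

section \<open>Dependence on the determinant\<close>

text \<open>\<open>T\<close> is the sum of the squares of the entries and \<open>\<delta>\<close> the modulus of the determinant.\<close>

definition sv_pair :: "real \<Rightarrow> real \<Rightarrow> real \<Rightarrow> real" where
  "sv_pair p T \<delta> = sqrt ((T + sqrt (T^2-4*\<delta>^2))/2) powr p + sqrt ((T - sqrt (T^2-4*\<delta>^2))/2) powr p"

text \<open>The squares of \<open>P\<close> and \<open>Q\<close> are \<open>T + 2*D\<close> and
  \<open>T - 2*D\<close>, so the inner root is \<open>P*Q\<close> and the outer radicands are the
  squares of \<open>(P+Q)/2\<close> and \<open>(P-Q)/2\<close>.\<close>

lemma sv_sum_eq_sv_pair: "sv_sum p a b c d = sv_pair p (a^2+b^2+c^2+d^2) \<bar>a*d-b*c\<bar>"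
proof -
  define P Q where "P = sqrt ((a+d)^2+(c-b)^2)" "Q = sqrt ((a-d)^2+(b+c)^2)"
  note PQ = this
  define T D where "T = a^2+b^2+c^2+d^2" "D = a*d-b*c"
  have PQ0: "0 \<le> P" "0 \<le> Q" by (simp_all add: PQ)
  have sq: "P^2 = T + 2*D" "Q^2 = T - 2*D"
    by (simp_all add: PQ T_D_def) (simp_all add: algebra_simps power2_eq_square)
  have "T^2 - 4*\<bar>D\<bar>^2 = (P*Q)^2"
    unfolding power_mult_distrib sq by (simp add: algebra_simps power2_eq_square)
  then have R: "sqrt (T^2 - 4*\<bar>D\<bar>^2) = P*Q" using PQ0 by (simp only: real_sqrt_abs abs_of_nonneg mult_nonneg_nonneg)
  have "((P+Q)/2)^2 = (T + P*Q)/2" "((P-Q)/2)^2 = (T - P*Q)/2"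
    using sq by (simp_all add: power_divide power2_sum power2_diff)
  then have st: "sqrt ((T + P*Q)/2) = (P+Q)/2" "sqrt ((T - P*Q)/2) = \<bar>(P-Q)/2\<bar>"
    using PQ0 by (metis abs_of_nonneg add_nonneg_nonneg divide_nonneg_pos real_sqrt_abs zero_less_numeral, metis real_sqrt_abs)
  show ?thesis unfolding sv_sum_def sv_pair_def Let_def PQ[symmetric] T_D_def[symmetric] R st ..
qed

text \<open>Moving two numbers apart with their sum fixed lowers a sum of concave powers and raises
  a sum of convex ones; the factor \<open>1-q\<close> unites both cases.\<close>

lemma powr_pair_antimono:
  fixes T q R R' :: real
  assumes "0 \<le> R" "R \<le> R'" "R' \<le> T" "q > 0"
  shows "(1-q) * (((T+R')/2) powr q + ((T-R')/2) powr q) \<le> (1-q) * (((T+R)/2) powr q + ((T-R)/2) powr q)"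
proof (rule DERIV_nonpos_imp_decreasing_open[OF assms(2)])
  \<comment> \<open>Only interior points need a derivative: at the right end \<open>(T-x)/2\<close>
    may vanish, and continuity is enough there.\<close>
  fix x assume x: "R < x" "x < R'"
  have pos: "(T+x)/2 > 0" "(T-x)/2 > 0" using x assms by simp_all
  have "((\<lambda>x. (1-q) * (((T+x)/2) powr q + ((T-x)/2) powr q)) has_real_derivative
      (1-q) * (q * ((T+x)/2) powr (q-1) * (1/2) + q * ((T-x)/2) powr (q-1) * (-1/2))) (at x)"
    using pos by (intro DERIV_cmult DERIV_add DERIV_chain2[OF has_real_derivative_powr])
      (auto intro!: derivative_eq_intros)
  moreover have "(1-q) * (q * ((T+x)/2) powr (q-1) * (1/2) + q * ((T-x)/2) powr (q-1) * (-1/2)) \<le> 0"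
  proof -
    have "(1-q) * (((T+x)/2) powr (q-1) - ((T-x)/2) powr (q-1)) \<le> 0"
    proof (cases "q \<le> 1")
      case True
      then have "((T+x)/2) powr (q-1) \<le> ((T-x)/2) powr (q-1)" using pos x assms by (intro powr_mono2') auto
      then show ?thesis using True by (intro mult_nonneg_nonpos) auto
    next
      case False
      then have "((T-x)/2) powr (q-1) \<le> ((T+x)/2) powr (q-1)" using pos x assms by (intro powr_mono2) auto
      then show ?thesis using False by (intro mult_nonpos_nonneg) auto
    qed
    then have "q/2 * ((1-q) * (((T+x)/2) powr (q-1) - ((T-x)/2) powr (q-1))) \<le> 0"
      using assms(4) by (intro mult_nonneg_nonpos[of "q/2"]) simp_all
    moreover have "q/2 * ((1-q) * (z-w)) = (1-q) * (q * z * (1/2) + q * w * (-1/2))" for z w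
      by (simp add: field_simps)
    ultimately show ?thesis by (simp only:)
  qed
  ultimately show "\<exists>y. ((\<lambda>x. (1-q) * (((T+x)/2) powr q + ((T-x)/2) powr q)) has_real_derivative y) (at x) \<and> y \<le> 0"
    by blast
next
  show "continuous_on {R..R'} (\<lambda>x. (1-q) * (((T+x)/2) powr q + ((T-x)/2) powr q))"
    using assms by (intro continuous_intros continuous_on_powr') auto
qed

text \<open>A larger determinant brings the squared singular values closer together while their sum
  stays \<open>T\<close>, and they enter with exponent \<open>p/2\<close>. The exponent 2 is settled
  separately because \<open>1-p/2\<close> vanishes.\<close>

lemma sv_pair_mono:
  assumes "0 \<le> \<delta>'" "\<delta>' \<le> \<delta>" "2*\<delta> \<le> T"
  shows "0 < p \<Longrightarrow> p \<le> 2 \<Longrightarrow> sv_pair p T \<delta>' \<le> sv_pair p T \<delta>"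
    and "2 \<le> p \<Longrightarrow> sv_pair p T \<delta> \<le> sv_pair p T \<delta>'"
proof -
  define R where "R \<delta> = sqrt (T^2-4*\<delta>^2)" for \<delta>
  have "(2*\<delta>)^2 \<le> T^2" using assms by (intro power_mono) auto
  then have "0 \<le> R \<delta>" by (simp add: R_def)
  moreover have "\<delta>'^2 \<le> \<delta>^2" using assms by (intro power_mono) auto
  then have "R \<delta> \<le> R \<delta>'" by (simp add: R_def)
  moreover have "R \<delta>' \<le> T" unfolding R_def by (rule real_le_lsqrt) (use assms in auto)
  ultimately have R: "0 \<le> R \<delta>" "R \<delta> \<le> R \<delta>'" "R \<delta>' \<le> T" "0 \<le> R \<delta>'" "R \<delta> \<le> T" by linarith+
  have eq: "sv_pair p T d = ((T + R d)/2) powr (p/2) + ((T - R d)/2) powr (p/2)" if "0 \<le> R d" "R d \<le> T" for p d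
    unfolding sv_pair_def R_def[symmetric] using that by (simp add: powr_half_sqrt[symmetric] powr_powr)
  have main: "(1-p/2) * sv_pair p T \<delta>' \<le> (1-p/2) * sv_pair p T \<delta>" if "p > 0" for p
    unfolding eq[OF R(4,3)] eq[OF R(1,5)] using R that by (intro powr_pair_antimono) auto
  have two: "sv_pair 2 T \<delta>' = sv_pair 2 T \<delta>"
    unfolding eq[OF R(4,3)] eq[OF R(1,5)] using R by (simp add: field_simps)
  show "sv_pair p T \<delta>' \<le> sv_pair p T \<delta>" if "0 < p" "p \<le> 2" using main[of p] two that by (cases "p = 2") simp_all
  show "sv_pair p T \<delta> \<le> sv_pair p T \<delta>'" if "2 \<le> p" using main[of p] two that by (cases "p = 2") simp_all
qed

section \<open>Schatten norms from a diagonalization\<close>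

lemma mat_adjoint_dim [simp]: "dim_row (mat_adjoint A) = dim_col A" "dim_col (mat_adjoint A) = dim_row A"
  unfolding mat_adjoint_def by simp_all

lemma mat_adjoint_carrier [simp]: "A \<in> carrier_mat n m \<Longrightarrow> mat_adjoint A \<in> carrier_mat m n"
  unfolding carrier_mat_def by simp

lemma mat_adjoint_index [simp]:
  "i < dim_col A \<Longrightarrow> j < dim_row A \<Longrightarrow> mat_adjoint A $$ (i, j) = conjugate (A $$ (j, i))"
  unfolding mat_adjoint_def by (simp add: mat_of_rows_def)

lemma mat_adjoint_adjoint [simp]: "mat_adjoint (mat_adjoint (A :: complex mat)) = A"
  by (rule eq_matI) auto

lemma mat_adjoint_mult:
  fixes A B :: "complex mat"
  assumes "A \<in> carrier_mat n m" "B \<in> carrier_mat m k"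
  shows "mat_adjoint (A * B) = mat_adjoint B * mat_adjoint A"
  using assms by (intro eq_matI) (auto simp: scalar_prod_def mult.commute intro!: sum.cong)

lemma mat_adjoint_diag [simp]: "mat_adjoint (mat_diag n f) = mat_diag n (\<lambda>i. cnj (f i))"
  by (rule eq_matI) (auto simp: mat_diag_def)

lemma mat_mult_index:
  assumes "A \<in> carrier_mat n m" "B \<in> carrier_mat m k" "i < n" "j < k"
  shows "(A * B) $$ (i, j) = (\<Sum>l<m. A $$ (i, l) * B $$ (l, j))"
  using assms by (auto simp: scalar_prod_def atLeast0LessThan intro!: sum.cong)

lemma unitary_matD:
  assumes "unitary_mat n U"
  shows "U \<in> carrier_mat n n" "mat_adjoint U \<in> carrier_mat n n"
    "mat_adjoint U * U = 1\<^sub>m n" "U * mat_adjoint U = 1\<^sub>m n"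
  using assms mat_mult_left_right_inverse[of "mat_adjoint U" n U] unfolding unitary_mat_def by auto

lemma cscalar_adjoint:
  fixes A :: "complex mat"
  assumes "A \<in> carrier_mat n m" "v \<in> carrier_vec m" "w \<in> carrier_vec n"
  shows "(A *\<^sub>v v) \<bullet>c w = v \<bullet>c (mat_adjoint A *\<^sub>v w)"
proof -
  have "(A *\<^sub>v v) \<bullet>c w = (\<Sum>i<n. \<Sum>j<m. A $$ (i,j) * vec_index v j * cnj (vec_index w i))"
    using assms by (auto simp: scalar_prod_def sum_distrib_right atLeast0LessThan intro!: sum.cong)
  also have "\<dots> = (\<Sum>j<m. \<Sum>i<n. A $$ (i,j) * vec_index v j * cnj (vec_index w i))"
    by (rule sum.swap)
  also have "\<dots> = v \<bullet>c (mat_adjoint A *\<^sub>v w)"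
    using assms by (auto simp: scalar_prod_def sum_distrib_left atLeast0LessThan mult_ac intro!: sum.cong)
  finally show ?thesis .
qed

lemma mult_square_carrier:
  "A \<in> carrier_mat n n \<Longrightarrow> B \<in> carrier_mat n n \<Longrightarrow> A * B \<in> carrier_mat n n"
  by simp

lemma psd_conj_unitary:
  assumes "psd_mat n P" "U \<in> carrier_mat n n"
  shows "psd_mat n (mat_adjoint U * P * U)"
proof -
  have P: "P \<in> carrier_mat n n" "mat_adjoint P = P" using assms by (auto simp: psd_mat_def)
  have "mat_adjoint (mat_adjoint U * P * U) = mat_adjoint U * P * U"
    using P assms(2) by (simp add: mat_adjoint_mult[of _ n n _ n] mult_square_carrier assoc_mult_mat[of _ n n _ n _ n])
  moreover have "0 \<le> Re ((mat_adjoint U * P * U *\<^sub>v v) \<bullet>c v)" if v: "v \<in> carrier_vec n" for v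
  proof -
    have Uv: "U *\<^sub>v v \<in> carrier_vec n" using assms(2) v by simp
    have "mat_adjoint U * P * U *\<^sub>v v = mat_adjoint U *\<^sub>v (P *\<^sub>v (U *\<^sub>v v))"
      using assms(2) P v by (simp add: mult_square_carrier assoc_mult_mat_vec[of _ n n _ n])
    then have "(mat_adjoint U * P * U *\<^sub>v v) \<bullet>c v = (P *\<^sub>v (U *\<^sub>v v)) \<bullet>c (U *\<^sub>v v)"
      using assms(2) P v Uv cscalar_adjoint[of "mat_adjoint U" n n "P *\<^sub>v (U *\<^sub>v v)" v] by simp
    then show ?thesis using assms(1) Uv by (simp add: psd_mat_def)
  qed
  ultimately show ?thesis using P assms(2) by (simp add: psd_mat_def mult_square_carrier)
qed

lemma Re_cscalar_mat_diag:
  assumes v: "v \<in> carrier_vec n"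
  shows "Re ((mat_diag n (\<lambda>i. complex_of_real (d i)) *\<^sub>v v) \<bullet>c v) = (\<Sum>i<n. d i * (cmod (vec_index v i))^2)"
proof -
  have "(mat_diag n (\<lambda>i. complex_of_real (d i)) *\<^sub>v v) \<bullet>c v
     = (\<Sum>i<n. complex_of_real (d i) * vec_index v i * cnj (vec_index v i))"
    using v by (auto simp: scalar_prod_def mat_diag_def atLeast0LessThan if_distrib[of "\<lambda>x. x * _"] sum.delta'
        cong: if_cong intro!: sum.cong)
  also have "Re \<dots> = (\<Sum>i<n. d i * (cmod (vec_index v i))^2)"
    by (simp add: mult.assoc complex_mult_cnj cmod_power2)
  finally show ?thesis .
qed

lemma psd_diag:
  assumes "\<And>i. i < n \<Longrightarrow> 0 \<le> d i"
  shows "psd_mat n (mat_diag n (\<lambda>i. complex_of_real (d i)))"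
proof -
  have "0 \<le> Re ((mat_diag n (\<lambda>i. complex_of_real (d i)) *\<^sub>v v) \<bullet>c v)" if "v \<in> carrier_vec n" for v
    unfolding Re_cscalar_mat_diag[OF that] using assms by (auto intro!: sum_nonneg)
  then show ?thesis by (simp add: psd_mat_def)
qed

text \<open>Uniqueness of the positive square root in a basis that diagonalizes the square:
  \<open>Q\<close> commutes with \<open>S\<close>, so the product of \<open>Q + S\<close> and
  \<open>Q - S\<close> is the difference of equal squares.\<close>

lemma psd_sqrt_diag_unique:
  assumes Q: "psd_mat n Q" and sq: "Q * Q = mat_diag n (\<lambda>i. complex_of_real ((\<sigma> i)^2))"
    and \<sigma>: "\<And>i. i < n \<Longrightarrow> 0 \<le> \<sigma> i"
  shows "Q = mat_diag n (\<lambda>i. complex_of_real (\<sigma> i))"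
proof -
  define S where "S = mat_diag n (\<lambda>i. complex_of_real (\<sigma> i))"
  have S: "S \<in> carrier_mat n n" "mat_adjoint S = S" "S * S = Q * Q"
    by (simp_all add: S_def sq power2_eq_square)
  have Qc: "Q \<in> carrier_mat n n" "mat_adjoint Q = Q" using Q by (auto simp: psd_mat_def)
  have QD: "Q * (Q * Q) = (Q * Q) * Q" using Qc by (simp add: assoc_mult_mat[of Q n n Q n Q n])
  \<comment> \<open>Entrywise, \<open>Q\<close> commuting with its square means that a nonzero
    \<open>Q $$ (i,j)\<close> forces equal squares, hence \<open>\<sigma> i = \<sigma> j\<close> as
    both are nonnegative.\<close>
  have comm: "Q * S = S * Q"
  proof (rule eq_matI)
    fix i j assume "i < dim_row (S * Q)" "j < dim_col (S * Q)"
    then have ij: "i < n" "j < n" using S Qc by auto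
    have "(Q * (Q * Q)) $$ (i,j) = Q $$ (i,j) * complex_of_real ((\<sigma> j)^2)"
      "((Q * Q) * Q) $$ (i,j) = complex_of_real ((\<sigma> i)^2) * Q $$ (i,j)"
      unfolding sq using Qc ij by (simp_all add: mat_diag_mult_left[of _ n n] mat_diag_mult_right[of _ n n])
    then have "Q $$ (i,j) = 0 \<or> (\<sigma> j)^2 = (\<sigma> i)^2" using QD
      by (metis mult.commute mult_cancel_left of_real_eq_iff)
    then have "Q $$ (i,j) = 0 \<or> \<sigma> j = \<sigma> i" using \<sigma> ij by (simp add: power2_eq_iff_nonneg)
    then show "(Q * S) $$ (i,j) = (S * Q) $$ (i,j)"
      unfolding S_def using Qc ij by (auto simp: mat_diag_mult_left[of _ n n] mat_diag_mult_right[of _ n n])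
  qed (use S Qc in auto)
  \<comment> \<open>Since \<open>(Q + S) W = 0\<close> with \<open>Q\<close>, \<open>S\<close> positive semidefinite, both annihilate the columns of \<open>W\<close>, so \<open>W\<^sup>2 = 0\<close>.\<close>
  define W where "W = Q - S"
  have W: "W \<in> carrier_mat n n" unfolding W_def by (intro minus_carrier_mat S)
  have Wadj: "mat_adjoint W = W"
  proof (rule eq_matI)
    fix i j assume "i < dim_row W" "j < dim_col W"
    then have ij: "i < n" "j < n" using W by auto
    have "Q $$ (i,j) = cnj (Q $$ (j,i))" "S $$ (i,j) = cnj (S $$ (j,i))"
      using ij Qc S mat_adjoint_index[of i Q j] mat_adjoint_index[of i S j] by auto
    then show "mat_adjoint W $$ (i,j) = W $$ (i,j)" using ij W Qc S by (simp add: W_def)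
  qed (use W in auto)
  have QW: "(Q + S) * W = 0\<^sub>m n n"
    unfolding W_def using S Qc comm
    by (simp add: add_mult_distrib_mat[of _ n n] mult_minus_distrib_mat[of _ n n]) auto
  have WW: "W * W = 0\<^sub>m n n"
  proof (rule mat_col_eqI)
    fix j assume "j < dim_col (0\<^sub>m n n :: complex mat)"
    then have j: "j < n" by simp
    define w where "w = col W j"
    have w: "w \<in> carrier_vec n" using W by (simp add: w_def carrier_vecI)
    have "(Q + S) *\<^sub>v w = col ((Q + S) * W) j" using W S Qc j by (simp add: w_def col_mult2[of _ n n])
    then have z: "Q *\<^sub>v w + S *\<^sub>v w = 0\<^sub>v n"
      using add_mult_distrib_mat_vec[of Q n n S w] S Qc w j unfolding QW by simp
    have "(Q *\<^sub>v w) \<bullet>c w + (S *\<^sub>v w) \<bullet>c w = (Q *\<^sub>v w + S *\<^sub>v w) \<bullet>c w"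
      using w S Qc by (simp add: add_scalar_prod_distrib[of _ n])
    also have "\<dots> = 0" unfolding z using w by simp
    finally have "Re ((Q *\<^sub>v w) \<bullet>c w) + Re ((S *\<^sub>v w) \<bullet>c w) = 0"
      by (metis plus_complex.simps(1) zero_complex.simps(1))
    moreover have "0 \<le> Re ((Q *\<^sub>v w) \<bullet>c w)" using Q w by (simp add: psd_mat_def)
    moreover have "Re ((S *\<^sub>v w) \<bullet>c w) = (\<Sum>i<n. \<sigma> i * (cmod (vec_index w i))^2)"
      unfolding S_def by (rule Re_cscalar_mat_diag[OF w])
    moreover have nn: "0 \<le> \<sigma> i * (cmod (vec_index w i))^2" if "i < n" for i using \<sigma> that by simp
    ultimately have "(\<Sum>i<n. \<sigma> i * (cmod (vec_index w i))^2) = 0"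
      using sum_nonneg[of "{..<n}" "\<lambda>i. \<sigma> i * (cmod (vec_index w i))^2"] by force
    then have "\<sigma> i * vec_index w i = 0" if "i < n" for i
      using nn that by (subst (asm) sum_nonneg_eq_0_iff) auto
    then have Sw0: "S *\<^sub>v w = 0\<^sub>v n"
      using w by (intro eq_vecI) (auto simp: S_def scalar_prod_def mat_diag_def if_distrib[of "\<lambda>x. x * _"] sum.delta'
            cong: if_cong)
    then have "Q *\<^sub>v w = 0\<^sub>v n" using z w Qc by simp
    then have "W *\<^sub>v w = 0\<^sub>v n" unfolding W_def using Sw0 w Qc S by (simp add: minus_mult_distrib_mat_vec[of _ n n])
    then show "col (W * W) j = col (0\<^sub>m n n) j"
      unfolding col_mult2[OF W W j] w_def using j by simp
  qed (use W in auto)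
  \<comment> \<open>As \<open>W\<close> is Hermitian, the diagonal entries of \<open>W * W\<close>
    are the squared norms of its columns.\<close>
  have "W $$ (i,j) = 0" if ij: "i < n" "j < n" for i j
  proof -
    have sym: "W $$ (j,k) = cnj (W $$ (k,j))" if "k < n" for k
      using mat_adjoint_index[of j W k] W ij that Wadj by simp
    have "0 = (W * W) $$ (j,j)" using WW ij by simp
    also have "\<dots> = (\<Sum>k<n. W $$ (j,k) * W $$ (k,j))" by (rule mat_mult_index[OF W W ij(2) ij(2)])
    also have "\<dots> = (\<Sum>k<n. complex_of_real ((cmod (W $$ (k,j)))^2))"
      by (intro sum.cong refl) (simp add: sym complex_norm_square[symmetric] mult.commute)
    finally have "(\<Sum>k<n. (cmod (W $$ (k,j)))^2) = 0" 
      by (metis of_real_0 of_real_eq_iff of_real_sum)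
    then show ?thesis using ij by (subst (asm) sum_nonneg_eq_0_iff) auto
  qed
  then have "Q $$ (i,j) = S $$ (i,j)" if "i < n" "j < n" for i j
    using that S Qc by (simp add: W_def)
  then show ?thesis using S Qc unfolding S_def[symmetric] by (intro eq_matI) auto
qed

text \<open>Conjugation by \<open>U\<close> reduces the uniqueness required by the definite
  description to the diagonal case.\<close>

lemma mat_abs_eqI:
  assumes X: "X \<in> carrier_mat n n" and U: "unitary_mat n U" and \<sigma>: "\<And>i. i < n \<Longrightarrow> 0 \<le> \<sigma> i"
    and sq: "mat_adjoint X * X = U * mat_diag n (\<lambda>i. complex_of_real ((\<sigma> i)^2)) * mat_adjoint U"
  shows "mat_abs X = U * mat_diag n (\<lambda>i. complex_of_real (\<sigma> i)) * mat_adjoint U"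
proof -
  note u = unitary_matD[OF U]
  define S where "S = mat_diag n (\<lambda>i. complex_of_real (\<sigma> i))"
  have S: "S \<in> carrier_mat n n" by (simp add: S_def)
  have SS: "S * S = mat_diag n (\<lambda>i. complex_of_real ((\<sigma> i)^2))" by (simp add: S_def power2_eq_square)
  have psd: "psd_mat n (U * S * mat_adjoint U)"
    using psd_conj_unitary[OF psd_diag[OF \<sigma>] u(2)] by (simp add: S_def)
  have cancel: "(V * M * W) * (mat_adjoint W * M' * V') = V * (M * M') * V'"
    if "V \<in> carrier_mat n n" "M \<in> carrier_mat n n" "W \<in> carrier_mat n n" "M' \<in> carrier_mat n n" "V' \<in> carrier_mat n n"
      "W * mat_adjoint W = 1\<^sub>m n" for V M W M' V' :: "complex mat"
  proof -
    have "(V * M * W) * (mat_adjoint W * M' * V') = V * M * (W * mat_adjoint W) * M' * V'"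
      using that(1-5) by (simp add: mult_square_carrier assoc_mult_mat[of _ n n _ n _ n])
    then show ?thesis using that by (simp add: mult_square_carrier assoc_mult_mat[of _ n n _ n _ n])
  qed
  have "(U * S * mat_adjoint U) * (mat_adjoint (mat_adjoint U) * S * mat_adjoint U) = U * (S * S) * mat_adjoint U"
    by (rule cancel) (use u S in simp_all)
  then have sq': "(U * S * mat_adjoint U) * (U * S * mat_adjoint U) = mat_adjoint X * X"
    by (simp add: sq SS)
  show ?thesis unfolding mat_abs_def S_def[symmetric]
  proof (rule the_equality)
    show "psd_mat (dim_row X) (U * S * mat_adjoint U) \<and>
      U * S * mat_adjoint U * (U * S * mat_adjoint U) = mat_adjoint X * X"
      using psd sq' X by auto
  next
    fix P assume "psd_mat (dim_row X) P \<and> P * P = mat_adjoint X * X"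
    then have P: "psd_mat n P" "P * P = mat_adjoint X * X" "P \<in> carrier_mat n n" using X by (auto simp: psd_mat_def)
    have "(mat_adjoint U * P * U) * (mat_adjoint U * P * U) = mat_adjoint U * (P * P) * U"
      by (rule cancel) (use u P in simp_all)
    also have "\<dots> = (mat_adjoint U * U) * (S * S) * (mat_adjoint U * U)"
      unfolding P sq SS[symmetric] using u(1,2) S by (simp add: mult_square_carrier assoc_mult_mat[of _ n n _ n _ n])
    also have "\<dots> = S * S"
      unfolding u(3) left_mult_one_mat[OF mult_square_carrier[OF S S]]
      by (rule right_mult_one_mat[OF mult_square_carrier[OF S S]])
    finally have "mat_adjoint U * P * U * (mat_adjoint U * P * U) = mat_diag n (\<lambda>i. complex_of_real ((\<sigma> i)^2))"
      unfolding SS .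
    from psd_sqrt_diag_unique[OF psd_conj_unitary[OF P(1) u(1)] this \<sigma>]
    have "mat_adjoint U * P * U = S" unfolding S_def .
    then have "U * S * mat_adjoint U = U * (mat_adjoint U * P * U) * mat_adjoint U" by simp
    also have "\<dots> = (U * mat_adjoint U) * P * (U * mat_adjoint U)"
      using u(1,2) P(3) by (simp add: mult_square_carrier assoc_mult_mat[of _ n n _ n _ n])
    finally show "P = U * S * mat_adjoint U" using u(4) P(3) by simp
  qed
qed

text \<open>Independence of the diagonalization: two of them are linked by
  \<open>M = mat_adjoint V * U\<close>, which intertwines the diagonals. A nonzero
  \<open>M $$ (i,j)\<close> forces \<open>d j = e i\<close>, so \<open>M\<close> intertwines the
  powers as well.\<close>

lemma psd_powr_eqI:
  assumes U: "unitary_mat n U" and d: "\<And>i. i < n \<Longrightarrow> 0 \<le> d i"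
  shows "psd_powr (U * mat_diag n (\<lambda>i. complex_of_real (d i)) * mat_adjoint U) s
     = U * mat_diag n (\<lambda>i. complex_of_real (d i powr s)) * mat_adjoint U"
proof -
  note u = unitary_matD[OF U]
  define D where "D d = mat_diag n (\<lambda>i. complex_of_real (d i))" for d :: "nat \<Rightarrow> real"
  have D: "D d \<in> carrier_mat n n" for d by (simp add: D_def)
  have dim: "dim_row (U * D d * mat_adjoint U) = n" using u by simp
  have uniq: "V * D (\<lambda>i. e i powr s) * mat_adjoint V = U * D (\<lambda>i. d i powr s) * mat_adjoint U"
    if V: "unitary_mat n V" and e: "\<forall>i<n. 0 \<le> e i" and eq: "U * D d * mat_adjoint U = V * D e * mat_adjoint V" for V e
  proof -
    note v = unitary_matD[OF V]
    define M where "M = mat_adjoint V * U"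
    have M: "M \<in> carrier_mat n n" unfolding M_def by (intro mult_square_carrier u v)
    have "M * D d = mat_adjoint V * (U * D d * mat_adjoint U) * U"
      unfolding M_def using u v D by (simp add: right_mult_one_mat[OF D] mult_square_carrier assoc_mult_mat[of _ n n _ n _ n])
    also have "\<dots> = (mat_adjoint V * V) * D e * (mat_adjoint V * U)"
      unfolding eq using u(1,2) v(1,2) D by (simp add: mult_square_carrier assoc_mult_mat[of _ n n _ n _ n])
    also have "\<dots> = D e * M" unfolding v(3) left_mult_one_mat[OF D] M_def ..
    finally have MD: "M * D d = D e * M" .
    have "M * D (\<lambda>i. d i powr s) = D (\<lambda>i. e i powr s) * M"
    proof (rule eq_matI)
      fix i j assume "i < dim_row (D (\<lambda>i. e i powr s) * M)" "j < dim_col (D (\<lambda>i. e i powr s) * M)"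
      then have ij: "i < n" "j < n" using M D[of "\<lambda>i. e i powr s"] by auto
      have "M $$ (i,j) * complex_of_real (d j) = complex_of_real (e i) * M $$ (i,j)"
        using arg_cong[OF MD, of "\<lambda>A. A $$ (i,j)"] M ij
        by (simp add: D_def mat_diag_mult_left[of _ n n] mat_diag_mult_right[of _ n n])
      then have "M $$ (i,j) = 0 \<or> d j = e i" by (metis mult.commute mult_cancel_left of_real_eq_iff)
      then show "(M * D (\<lambda>i. d i powr s)) $$ (i,j) = (D (\<lambda>i. e i powr s) * M) $$ (i,j)"
        using M ij by (auto simp: D_def mat_diag_mult_left[of _ n n] mat_diag_mult_right[of _ n n])
    qed (use M in \<open>auto simp: D_def mat_diag_def\<close>)
    then have "V * (M * D (\<lambda>i. d i powr s)) * mat_adjoint U = V * (D (\<lambda>i. e i powr s) * M) * mat_adjoint U" by simp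
    moreover have "V * (M * D (\<lambda>i. d i powr s)) * mat_adjoint U = (V * mat_adjoint V) * U * D (\<lambda>i. d i powr s) * mat_adjoint U"
      unfolding M_def using u(1,2) v(1,2) D by (simp add: mult_square_carrier assoc_mult_mat[of _ n n _ n _ n])
    moreover have "V * (D (\<lambda>i. e i powr s) * M) * mat_adjoint U = V * D (\<lambda>i. e i powr s) * mat_adjoint V * (U * mat_adjoint U)"
      unfolding M_def using u(1,2) v(1,2) D by (simp add: mult_square_carrier assoc_mult_mat[of _ n n _ n _ n])
    ultimately show ?thesis using u v D by simp
  qed
  show ?thesis unfolding psd_powr_def D_def[symmetric] dim
    by (rule the_equality) (use U d uniq in blast)+
qed

lemma mat_trace_conj_diag:
  assumes U: "unitary_mat n U"
  shows "mat_trace (U * mat_diag n f * mat_adjoint U) = (\<Sum>i<n. f i)"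
proof -
  note u = unitary_matD[OF U]
  have UD: "U * mat_diag n f \<in> carrier_mat n n" using u by simp
  have "mat_trace (U * mat_diag n f * mat_adjoint U) = (\<Sum>i<n. \<Sum>k<n. U $$ (i,k) * f k * cnj (U $$ (i,k)))"
  proof -
    have "(U * mat_diag n f * mat_adjoint U) $$ (i,i) = (\<Sum>k<n. U $$ (i,k) * f k * cnj (U $$ (i,k)))" if "i < n" for i
      unfolding mat_mult_index[OF UD u(2) that that] using u(1) that
      by (auto simp: mat_diag_mult_right[OF u(1)] intro!: sum.cong)
    then show ?thesis unfolding mat_trace_def using u(1) by simp
  qed
  also have "\<dots> = (\<Sum>k<n. f k * (\<Sum>i<n. cnj (U $$ (i,k)) * U $$ (i,k)))"
    by (subst sum.swap) (simp add: sum_distrib_left mult_ac)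
  also have "\<dots> = (\<Sum>k<n. f k)"
  proof (intro sum.cong refl)
    fix k assume "k \<in> {..<n}"
    then have k: "k < n" by simp
    have "(\<Sum>i<n. cnj (U $$ (i,k)) * U $$ (i,k)) = (mat_adjoint U * U) $$ (k,k)"
      unfolding mat_mult_index[OF u(2,1) k k] using u(1) k by (auto intro!: sum.cong)
    then show "f k * (\<Sum>i<n. cnj (U $$ (i,k)) * U $$ (i,k)) = f k" using u(3) k by simp
  qed
  finally show ?thesis .
qed

text \<open>Lets a norm be computed from any unitary diagonalization of
  \<open>mat_adjoint X * X\<close>, without reference to the definite descriptions.\<close>

lemma schatten_norm_eqI:
  assumes X: "X \<in> carrier_mat n n" and U: "unitary_mat n U" and \<sigma>: "\<And>i. i < n \<Longrightarrow> 0 \<le> \<sigma> i"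
    and sq: "mat_adjoint X * X = U * mat_diag n (\<lambda>i. complex_of_real ((\<sigma> i)^2)) * mat_adjoint U"
  shows "schatten_norm p X = (\<Sum>i<n. \<sigma> i powr p) powr (1/p)"
proof -
  have "mat_abs X = U * mat_diag n (\<lambda>i. complex_of_real (\<sigma> i)) * mat_adjoint U"
    by (rule mat_abs_eqI[OF X U _ sq]) (rule \<sigma>)
  moreover have "psd_powr (U * mat_diag n (\<lambda>i. complex_of_real (\<sigma> i)) * mat_adjoint U) p
      = U * mat_diag n (\<lambda>i. complex_of_real (\<sigma> i powr p)) * mat_adjoint U"
    by (rule psd_powr_eqI[OF U]) (rule \<sigma>)
  ultimately show ?thesis by (simp add: schatten_norm_def mat_trace_conj_diag[OF U])
qed

section \<open>Matrices with diagonal blocks\<close>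

lemma diagonal_mat_eq_mat_diag:
  assumes "A \<in> carrier_mat n n" "diagonal_mat A"
  shows "A = mat_diag n (\<lambda>i. A $$ (i, i))"
  using assms by (intro eq_matI) (auto simp: mat_diag_def diagonal_mat_def)

lemma mat_adjoint_one: "mat_adjoint (1\<^sub>m n :: complex mat) = 1\<^sub>m n"
  by (rule eq_matI) auto

lemma unitary_one: "unitary_mat n (1\<^sub>m n)"
  by (simp add: unitary_mat_def mat_adjoint_one)

lemma mat_diag_adjoint_mult:
  "mat_adjoint (mat_diag n a) * mat_diag n a
    = 1\<^sub>m n * mat_diag n (\<lambda>i. complex_of_real ((cmod (a i))^2)) * mat_adjoint (1\<^sub>m n)"
proof -
  have "cnj (a i) * a i = complex_of_real ((cmod (a i))^2)" for i
    by (metis complex_norm_square mult.commute)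
  then show ?thesis
    by (simp only: mat_adjoint_one mat_adjoint_diag mat_diag_diag
        left_mult_one_mat[OF mat_diag_dim] right_mult_one_mat[OF mat_diag_dim])
qed

lemma mat_abs_mat_diag: "mat_abs (mat_diag n a) = mat_diag n (\<lambda>i. complex_of_real (cmod (a i)))"
  by (subst mat_abs_eqI[OF mat_diag_dim unitary_one _ mat_diag_adjoint_mult])
    (simp_all add: mat_adjoint_one left_mult_one_mat[of _ n n] right_mult_one_mat[of _ n n])

lemma schatten_norm_mat_diag: "schatten_norm p (mat_diag n a) = (\<Sum>i<n. cmod (a i) powr p) powr (1/p)"
  by (rule schatten_norm_eqI[OF mat_diag_dim unitary_one _ mat_diag_adjoint_mult]) simp

text \<open>Such matrices multiply and take adjoints index by index like 2 by 2 matrices, so the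
  permutation into a direct sum is never carried out.\<close>

definition diag_block ::
    "nat \<Rightarrow> (nat \<Rightarrow> complex) \<Rightarrow> (nat \<Rightarrow> complex) \<Rightarrow> (nat \<Rightarrow> complex) \<Rightarrow> (nat \<Rightarrow> complex) \<Rightarrow> complex mat" where
  "diag_block n a b c d = four_block_mat (mat_diag n a) (mat_diag n b) (mat_diag n c) (mat_diag n d)"

lemma diag_block_carrier [simp]: "diag_block n a b c d \<in> carrier_mat (n+n) (n+n)"
  unfolding diag_block_def by (rule four_block_carrier_mat) simp_all

lemma mat_diag_add: "mat_diag n f + mat_diag n g = mat_diag n (\<lambda>i. f i + g i :: complex)"
  by (rule eq_matI) (auto simp: mat_diag_def)

lemma diag_block_mult:
  "diag_block n a b c d * diag_block n a' b' c' d' = diag_block n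
     (\<lambda>i. a i * a' i + b i * c' i) (\<lambda>i. a i * b' i + b i * d' i)
     (\<lambda>i. c i * a' i + d i * c' i) (\<lambda>i. c i * b' i + d i * d' i)"
  unfolding diag_block_def
  by (subst mult_four_block_mat[of _ n n _ n _ n _ _ n _ n]) (simp_all add: mat_diag_add)

lemma diag_block_adjoint:
  "mat_adjoint (diag_block n a b c d)
    = diag_block n (\<lambda>i. cnj (a i)) (\<lambda>i. cnj (c i)) (\<lambda>i. cnj (b i)) (\<lambda>i. cnj (d i))"
  unfolding diag_block_def by (rule eq_matI) (auto simp: mat_diag_def)

lemma diag_block_cong:
  assumes "\<And>i. i < n \<Longrightarrow> a i = a' i \<and> b i = b' i \<and> c i = c' i \<and> d i = d' i"
  shows "diag_block n a b c d = diag_block n a' b' c' d'"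
  unfolding diag_block_def using assms by (intro eq_matI) (auto simp: mat_diag_def)

lemma diag_block_diag: "mat_diag (n+n) f = diag_block n f (\<lambda>_. 0) (\<lambda>_. 0) (\<lambda>i. f (n+i))"
  unfolding diag_block_def by (rule eq_matI) (auto simp: mat_diag_def)

text \<open>\<open>(g, k)\<close> and \<open>(h, l)\<close> are orthonormal eigenvectors of the
  Hermitian matrix with diagonal \<open>u\<close>, \<open>v\<close> and upper right entry
  \<open>w\<close>. They come from a rotation by half the angle with cosine \<open>(u-v)/R\<close>,
  twisted by the phase of \<open>w\<close>.\<close>

lemma hermitian_2x2_diagonalization:
  fixes u v :: real and w :: complex
  defines "R \<equiv> sqrt ((u-v)^2 + 4*(cmod w)^2)"
  shows "\<exists>g h k l. cnj g*g + cnj k*k = 1 \<and> cnj h*h + cnj l*l = 1 \<and> cnj g*h + cnj k*l = 0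
    \<and> g * complex_of_real ((u+v+R)/2) * cnj g + h * complex_of_real ((u+v-R)/2) * cnj h = complex_of_real u
    \<and> g * complex_of_real ((u+v+R)/2) * cnj k + h * complex_of_real ((u+v-R)/2) * cnj l = w
    \<and> k * complex_of_real ((u+v+R)/2) * cnj k + l * complex_of_real ((u+v-R)/2) * cnj l = complex_of_real v"
proof -
  \<comment> \<open>For \<open>R = 0\<close> the quotient is 0 and \<open>u = v\<close>, so
    \<open>R * x = u - v\<close> holds in every case.\<close>
  define x where "x = (u-v)/R"
  have R0: "R \<ge> 0" by (simp add: R_def)
  have R2: "R^2 = (u-v)^2 + 4*(cmod w)^2" by (simp add: R_def)
  have Rx: "R * x = u - v"
  proof (cases "R = 0")
    case True
    then have "(u-v)^2 + 4*(cmod w)^2 = 0" using R2 by simp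
    then have "(u-v)^2 = 0" by (smt (verit) zero_le_power2)
    then show ?thesis using True by simp
  qed (simp add: x_def)
  have x2: "x^2 \<le> 1"
  proof -
    have "(u-v)^2 \<le> R^2" unfolding R2 by simp
    then show ?thesis by (auto simp: x_def power_divide divide_le_eq_1)
  qed
  then have x1: "-1 \<le> x \<and> x \<le> 1" by (auto simp: abs_square_le_1 abs_le_iff)
  define c s where "c = sqrt ((1+x)/2)" "s = sqrt ((1-x)/2)"
  have cs: "c^2 = (1+x)/2" "s^2 = (1-x)/2" "c \<ge> 0" "s \<ge> 0" using x1 by (simp_all add: c_s_def)
  have Rcs: "R * (c * s) = cmod w"
  proof (rule power2_eq_imp_eq)
    have "(R * (c * s))^2 = R^2 * (c^2 * s^2)" by (simp add: power_mult_distrib)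
    also have "\<dots> = (R^2 - (R*x)^2)/4" unfolding cs by (simp add: field_simps power2_eq_square)
    also have "\<dots> = (cmod w)^2" unfolding Rx R2 by simp
    finally show "(R * (c * s))^2 = (cmod w)^2" .
  qed (use R0 cs in auto)
  \<comment> \<open>The phase of \<open>w\<close>, with the unit number 1 as default when
    \<open>w = 0\<close>.\<close>
  define e where "e = (if w = 0 then 1 else w / complex_of_real (cmod w))"
  have e: "cnj e * e = 1" "complex_of_real (cmod w) * e = w"
    by (auto simp: e_def complex_norm_square[symmetric] mult.commute[of "cnj w"] power2_eq_square)
  let ?g = "complex_of_real c" and ?h = "- complex_of_real s * e" and ?k = "complex_of_real s * cnj e"
  have c1: "complex_of_real c * complex_of_real c = complex_of_real ((1+x)/2)"
    and s1: "complex_of_real s * complex_of_real s = complex_of_real ((1-x)/2)"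
    using cs by (metis of_real_mult power2_eq_square)+
  have ee: "e * cnj e = 1" using e(1) by (simp add: mult.commute)
  have "cnj ?g * ?g + cnj ?k * ?k = ?g * ?g + (complex_of_real s * complex_of_real s) * (e * cnj e)" by simp
  moreover have "cnj ?h * ?h + cnj ?g * ?g = ?g * ?g + (complex_of_real s * complex_of_real s) * (e * cnj e)" by simp
  moreover have "?g * ?g + (complex_of_real s * complex_of_real s) * (e * cnj e) = 1"
    unfolding c1 s1 ee by (simp add: field_simps)
  moreover have "cnj ?g * ?h + cnj ?k * ?g = 0" by simp
  moreover have "?g * complex_of_real a * cnj ?g + ?h * complex_of_real b * cnj ?h
      = complex_of_real ((1+x)/2 * a + (1-x)/2 * b)" for a b
  proof -
    have "?g * complex_of_real a * cnj ?g + ?h * complex_of_real b * cnj ?h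
      = (?g * ?g) * complex_of_real a + (complex_of_real s * complex_of_real s) * (e * cnj e) * complex_of_real b"
      by simp
    then show ?thesis unfolding c1 s1 ee by simp
  qed
  moreover have "?k * complex_of_real a * cnj ?k + ?g * complex_of_real b * cnj ?g
      = complex_of_real ((1-x)/2 * a + (1+x)/2 * b)" for a b
  proof -
    have "?k * complex_of_real a * cnj ?k + ?g * complex_of_real b * cnj ?g
      = (complex_of_real s * complex_of_real s) * (e * cnj e) * complex_of_real a + (?g * ?g) * complex_of_real b"
      by simp
    then show ?thesis unfolding c1 s1 ee by simp
  qed
  moreover have "?g * complex_of_real a * cnj ?k + ?h * complex_of_real b * cnj ?g
      = complex_of_real ((a-b) * (c * s)) * e" for a b
    by (simp add: algebra_simps)
  moreover have "(u+v+R)/2 - (u+v-R)/2 = R" by (simp add: field_simps)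
  moreover have "(1+x)/2 * ((u+v+R)/2) + (1-x)/2 * ((u+v-R)/2) = (u+v+R*x)/2"
    "(1-x)/2 * ((u+v+R)/2) + (1+x)/2 * ((u+v-R)/2) = (u+v-R*x)/2" by (simp_all add: field_simps)
  ultimately show ?thesis
    by (intro exI[of _ ?g] exI[of _ ?h] exI[of _ ?k] conjI) (simp_all only: Rcs Rx e(2), simp_all)
qed

lemma sum_lessThan_add:
  fixes n m :: nat shows "(\<Sum>i<n+m. f i) = (\<Sum>i<n. f i) + (\<Sum>i<m. f (n+i) :: 'a::comm_monoid_add)"
  by (induction m) (simp_all add: add.assoc)

text \<open>At each index, \<open>mat_adjoint X * X\<close> is the Gram matrix of two columns, with
  diagonal \<open>u\<close>, \<open>v\<close> and upper entry \<open>w\<close>. Its eigenvalues are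
  the squared singular values inside \<open>sv_pair\<close>.\<close>

lemma schatten_norm_diag_block:
  "schatten_norm p (diag_block n a b c d) = (\<Sum>i<n. sv_pair p
     ((cmod (a i))^2 + (cmod (b i))^2 + (cmod (c i))^2 + (cmod (d i))^2) (cmod (a i * d i - b i * c i))) powr (1/p)"
proof -
  define u v w where "u i = (cmod (a i))^2 + (cmod (c i))^2" "v i = (cmod (b i))^2 + (cmod (d i))^2"
    "w i = cnj (a i) * b i + cnj (c i) * d i" for i
  note uvw = this
  define R where "R i = sqrt ((u i - v i)^2 + 4*(cmod (w i))^2)" for i
  define T \<delta> where "T i = (cmod (a i))^2 + (cmod (b i))^2 + (cmod (c i))^2 + (cmod (d i))^2"
    "\<delta> i = cmod (a i * d i - b i * c i)" for i
  note T\<delta> = this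
  have Tuv: "T i = u i + v i" for i by (simp add: T\<delta> uvw)
  have R2: "(u i - v i)^2 + 4*(cmod (w i))^2 = (T i)^2 - 4*(\<delta> i)^2" for i
  proof -
    \<comment> \<open>The determinant of the Gram matrix is the squared modulus of the determinant,
      so the discriminant depends on \<open>T\<close> and \<delta> alone.\<close>
    have "(cmod (w i))^2 + (\<delta> i)^2 = u i * v i"
      unfolding uvw T\<delta> cmod_power2 by (simp add: algebra_simps power2_eq_square)
    then show ?thesis unfolding Tuv by (simp add: algebra_simps power2_eq_square)
  qed
  have R: "R i = sqrt ((T i)^2 - 4*(\<delta> i)^2)" for i unfolding R_def R2 ..
  have RT: "R i \<le> T i" for i
    unfolding R by (rule real_le_lsqrt) (simp_all add: T\<delta>)
  have R0: "0 \<le> R i" for i by (simp add: R_def)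
  define s1 s2 where "s1 i = sqrt ((T i + R i)/2)" "s2 i = sqrt ((T i - R i)/2)" for i
  have s: "(s1 i)^2 = (T i + R i)/2" "(s2 i)^2 = (T i - R i)/2" "0 \<le> s1 i" "0 \<le> s2 i" for i
    using RT[of i] R0[of i] by (simp_all add: s1_s2_def)
  have "\<forall>i. \<exists>g h k l. cnj g*g + cnj k*k = 1 \<and> cnj h*h + cnj l*l = 1 \<and> cnj g*h + cnj k*l = 0
    \<and> g * complex_of_real ((u i+v i+R i)/2) * cnj g + h * complex_of_real ((u i+v i-R i)/2) * cnj h = complex_of_real (u i)
    \<and> g * complex_of_real ((u i+v i+R i)/2) * cnj k + h * complex_of_real ((u i+v i-R i)/2) * cnj l = w i
    \<and> k * complex_of_real ((u i+v i+R i)/2) * cnj k + l * complex_of_real ((u i+v i-R i)/2) * cnj l = complex_of_real (v i)"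
    unfolding R_def by (intro allI hermitian_2x2_diagonalization)
  then obtain g h k l where uni: "\<And>i. cnj (g i)*g i + cnj (k i)*k i = 1" "\<And>i. cnj (h i)*h i + cnj (l i)*l i = 1"
      "\<And>i. cnj (g i)*h i + cnj (k i)*l i = 0"
    and dg: "\<And>i. g i * complex_of_real ((s1 i)^2) * cnj (g i) + h i * complex_of_real ((s2 i)^2) * cnj (h i) = complex_of_real (u i)"
      "\<And>i. g i * complex_of_real ((s1 i)^2) * cnj (k i) + h i * complex_of_real ((s2 i)^2) * cnj (l i) = w i"
      "\<And>i. k i * complex_of_real ((s1 i)^2) * cnj (k i) + l i * complex_of_real ((s2 i)^2) * cnj (l i) = complex_of_real (v i)"
    unfolding s Tuv choice_iff by blast
  define U where "U = diag_block n g h k l"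
  \<comment> \<open>The first \<open>n\<close> positions carry the larger singular value of each
    index and the last \<open>n\<close> the smaller one, matching the block layout.\<close>
  define \<sigma> where "\<sigma> i = (if i < n then s1 i else s2 (i-n))" for i
  have uni': "cnj (h i)*g i + cnj (l i)*k i = 0" for i
    using arg_cong[OF uni(3)[of i], of cnj] by (simp add: mult.commute)
  have U: "unitary_mat (n+n) U"
  proof -
    have "mat_adjoint U * U = diag_block n (\<lambda>_. 1) (\<lambda>_. 0) (\<lambda>_. 0) (\<lambda>_. 1)"
      unfolding U_def diag_block_adjoint diag_block_mult uni uni' ..
    also have "\<dots> = 1\<^sub>m (n+n)" unfolding mat_diag_one[symmetric] diag_block_diag ..
    finally show ?thesis by (simp add: unitary_mat_def U_def)
  qed
  have dg': "k i * complex_of_real ((s1 i)^2) * cnj (g i) + l i * complex_of_real ((s2 i)^2) * cnj (h i) = cnj (w i)" for i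
    using arg_cong[OF dg(2)[of i], of cnj] by (simp add: mult_ac)
  have X: "mat_adjoint (diag_block n a b c d) * diag_block n a b c d
     = diag_block n (\<lambda>i. complex_of_real (u i)) w (\<lambda>i. cnj (w i)) (\<lambda>i. complex_of_real (v i))"
    unfolding diag_block_adjoint diag_block_mult
    by (rule diag_block_cong) (auto simp: uvw complex_norm_square mult.commute simp del: of_real_power)
  have "mat_diag (n+n) (\<lambda>i. complex_of_real ((\<sigma> i)^2))
      = diag_block n (\<lambda>i. complex_of_real ((s1 i)^2)) (\<lambda>_. 0) (\<lambda>_. 0) (\<lambda>i. complex_of_real ((s2 i)^2))"
    unfolding diag_block_diag by (rule diag_block_cong) (auto simp: \<sigma>_def)
  then have UDU: "U * mat_diag (n+n) (\<lambda>i. complex_of_real ((\<sigma> i)^2)) * mat_adjoint U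
      = diag_block n (\<lambda>i. complex_of_real (u i)) w (\<lambda>i. cnj (w i)) (\<lambda>i. complex_of_real (v i))"
    unfolding U_def diag_block_adjoint
    by (simp only: mult_zero_right add_0_right add_0_left diag_block_mult) (rule diag_block_cong, use dg dg' in simp)
  from schatten_norm_eqI[OF diag_block_carrier U _ trans[OF X UDU[symmetric]]]
  have "schatten_norm p (diag_block n a b c d) = (\<Sum>i<n+n. \<sigma> i powr p) powr (1/p)"
    by (simp add: \<sigma>_def s)
  also have "(\<Sum>i<n+n. \<sigma> i powr p) = (\<Sum>i<n. s1 i powr p + s2 i powr p)"
    by (simp add: sum_lessThan_add \<sigma>_def sum.distrib)
  finally show ?thesis unfolding sv_pair_def s1_s2_def R T\<delta> .
qed

text \<open>With blocks of size 1, the matrix of norms falls under the same norm formula.\<close>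

lemma mat_of_rows_list_eq_diag_block:
  "mat_of_rows_list 2 [[x, y], [z, w]] = diag_block 1 (\<lambda>_. x) (\<lambda>_. y) (\<lambda>_. z) (\<lambda>_. w)"
  unfolding diag_block_def mat_of_rows_list_def
  by (rule eq_matI) (auto simp: mat_diag_def less_2_cases_iff numeral_2_eq_2 less_Suc_eq)

theorem theorem1:
  fixes n :: nat and A B C D :: "complex mat"
  assumes "n \<ge> 1"
    and "A \<in> carrier_mat n n" "B \<in> carrier_mat n n"
        "C \<in> carrier_mat n n" "D \<in> carrier_mat n n"
    and "diagonal_mat A" "diagonal_mat B" "diagonal_mat C" "diagonal_mat D"
  shows "(\<forall>p::real. 1 \<le> p \<and> p \<le> 2 \<longrightarrow>
            schatten_norm p (four_block_mat A B C D)
              \<ge> schatten_norm p (four_block_mat (mat_abs A) (mat_abs B) (mat_abs C) (mat_abs D)) \<and>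
            schatten_norm p (four_block_mat (mat_abs A) (mat_abs B) (mat_abs C) (mat_abs D))
              \<ge> schatten_norm p (mat_of_rows_list 2
                   [[complex_of_real (schatten_norm p A), complex_of_real (schatten_norm p B)],
                    [complex_of_real (schatten_norm p C), complex_of_real (schatten_norm p D)]])) \<and>
         (\<forall>p::real. 2 \<le> p \<longrightarrow>
            schatten_norm p (four_block_mat A B C D)
              \<le> schatten_norm p (four_block_mat (mat_abs A) (mat_abs B) (mat_abs C) (mat_abs D)) \<and>
            schatten_norm p (four_block_mat (mat_abs A) (mat_abs B) (mat_abs C) (mat_abs D))
              \<le> schatten_norm p (mat_of_rows_list 2
                   [[complex_of_real (schatten_norm p A), complex_of_real (schatten_norm p B)],
                    [complex_of_real (schatten_norm p C), complex_of_real (schatten_norm p D)]]))"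
proof -
  define a b c d where "a i = A $$ (i,i)" "b i = B $$ (i,i)" "c i = C $$ (i,i)" "d i = D $$ (i,i)" for i
  have A: "A = mat_diag n a" "B = mat_diag n b" "C = mat_diag n c" "D = mat_diag n d"
    unfolding a_b_c_d_def using assms by (auto intro: diagonal_mat_eq_mat_diag)
  define T where "T i = (cmod (a i))^2 + (cmod (b i))^2 + (cmod (c i))^2 + (cmod (d i))^2" for i
  define \<delta> where "\<delta> i = cmod (a i * d i - b i * c i)" for i
  \<comment> \<open>The modulus of the determinant after passing to absolute values; the reverse
    triangle inequality bounds it by \<delta>.\<close>
  define \<delta>' where "\<delta>' i = \<bar>cmod (a i) * cmod (d i) - cmod (b i) * cmod (c i)\<bar>" for i
  have bounds: "0 \<le> \<delta>' i" "\<delta>' i \<le> \<delta> i" "2 * \<delta> i \<le> T i" for i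
  proof -
    show "0 \<le> \<delta>' i" by (simp add: \<delta>'_def)
    show "\<delta>' i \<le> \<delta> i" unfolding \<delta>_def \<delta>'_def norm_mult[symmetric] by (rule norm_triangle_ineq3)
    have "\<delta> i \<le> cmod (a i) * cmod (d i) + cmod (b i) * cmod (c i)"
      unfolding \<delta>_def norm_mult[symmetric] by (rule norm_triangle_ineq4)
    moreover have "2 * (x * y) \<le> x^2 + y^2" for x y :: real using sum_squares_bound[of x y] by simp
    from add_mono[OF this[of "cmod (a i)" "cmod (d i)"] this[of "cmod (b i)" "cmod (c i)"]]
    have "2 * (cmod (a i) * cmod (d i) + cmod (b i) * cmod (c i)) \<le> T i" by (simp add: T_def)
    ultimately show "2 * \<delta> i \<le> T i" by (meson mult_left_mono order_trans zero_le_numeral)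
  qed
  \<comment> \<open>The coordinates of \<open>sv_sum_powr\<close>. Their sums over \<open>i\<close>,
    raised to the power \<open>1/p\<close>, are the norms of the four blocks.\<close>
  define x1 x2 x3 x4 where "x1 p i = cmod (a i) powr p" "x2 p i = cmod (b i) powr p"
    "x3 p i = cmod (c i) powr p" "x4 p i = cmod (d i) powr p" for p i
  note x = this
  have x0: "x1 p i \<ge> 0" "x2 p i \<ge> 0" "x3 p i \<ge> 0" "x4 p i \<ge> 0" for p i by (simp_all add: x)
  have full: "schatten_norm p (four_block_mat A B C D) = (\<Sum>i<n. sv_pair p (T i) (\<delta> i)) powr (1/p)" for p
    unfolding A diag_block_def[symmetric] schatten_norm_diag_block T_def \<delta>_def ..
  have "schatten_norm p (four_block_mat (mat_abs A) (mat_abs B) (mat_abs C) (mat_abs D))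
      = (\<Sum>i<n. sv_pair p (T i) (\<delta>' i)) powr (1/p)" for p
  proof -
    have "cmod (of_real x * of_real y - of_real z * of_real w) = \<bar>x * y - z * w\<bar>" for x y z w :: real
      by (metis norm_of_real of_real_diff of_real_mult)
    then show ?thesis
      unfolding A mat_abs_mat_diag diag_block_def[symmetric] schatten_norm_diag_block T_def \<delta>'_def by simp
  qed
  note mid = this
  have pair: "sv_pair p (T i) (\<delta>' i) = sv_sum_powr p (x1 p i) (x2 p i) (x3 p i) (x4 p i)" if "p \<ge> 1" for p i
    using that unfolding T_def \<delta>'_def sv_sum_eq_sv_pair[symmetric] sv_sum_powr_def x by (simp add: powr_powr)
  have small: "schatten_norm p (mat_of_rows_list 2
                   [[complex_of_real (schatten_norm p A), complex_of_real (schatten_norm p B)],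
                    [complex_of_real (schatten_norm p C), complex_of_real (schatten_norm p D)]])
     = sv_sum_powr p (\<Sum>i<n. x1 p i) (\<Sum>i<n. x2 p i) (\<Sum>i<n. x3 p i) (\<Sum>i<n. x4 p i) powr (1/p)" for p
  proof -
    define X Y Z W where "X = schatten_norm p A" "Y = schatten_norm p B" "Z = schatten_norm p C" "W = schatten_norm p D"
    note XY = this
    have "cmod (of_real X * of_real W - of_real Y * of_real Z) = \<bar>X * W - Y * Z\<bar>"
      by (metis norm_of_real of_real_diff of_real_mult)
    then have "schatten_norm p (mat_of_rows_list 2 [[of_real X, of_real Y], [of_real Z, of_real W]])
        = sv_sum p X Y Z W powr (1/p)"
      unfolding mat_of_rows_list_eq_diag_block schatten_norm_diag_block sv_sum_eq_sv_pair by simp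
    then show ?thesis unfolding XY sv_sum_powr_def x unfolding A schatten_norm_mat_diag .
  qed
  have pair0: "0 \<le> sv_pair p t e" for p t e by (simp add: sv_pair_def)
  have sum0: "0 \<le> sv_sum_powr p y1 y2 y3 y4" for p y1 y2 y3 y4 by (simp add: sv_sum_powr_def sv_sum_eq_sv_pair pair0)
  show ?thesis unfolding full mid small
  proof (intro conjI allI impI; (elim conjE)?)
    \<comment> \<open>The power \<open>1/p\<close> is monotone, so sums are compared: term by term
      through the determinants for the first inequality, by subadditivity for the second.\<close>
    fix p :: real assume p: "1 \<le> p" "p \<le> 2"
    show "(\<Sum>i<n. sv_pair p (T i) (\<delta>' i)) powr (1/p) \<le> (\<Sum>i<n. sv_pair p (T i) (\<delta> i)) powr (1/p)"
      using p by (intro powr_mono2 sum_mono sum_nonneg pair0 sv_pair_mono(1) bounds) auto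
    show "sv_sum_powr p (\<Sum>i<n. x1 p i) (\<Sum>i<n. x2 p i) (\<Sum>i<n. x3 p i) (\<Sum>i<n. x4 p i) powr (1/p)
        \<le> (\<Sum>i<n. sv_pair p (T i) (\<delta>' i)) powr (1/p)"
      unfolding pair[OF p(1)] using p by (intro powr_mono2 sum0 sv_sum_powr_sum(1) x0) auto
  next
    fix p :: real assume p: "2 \<le> p"
    then have p1: "1 \<le> p" by simp
    show "(\<Sum>i<n. sv_pair p (T i) (\<delta> i)) powr (1/p) \<le> (\<Sum>i<n. sv_pair p (T i) (\<delta>' i)) powr (1/p)"
      using p by (intro powr_mono2 sum_mono sum_nonneg pair0 sv_pair_mono(2) bounds) auto
    show "(\<Sum>i<n. sv_pair p (T i) (\<delta>' i)) powr (1/p)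
        \<le> sv_sum_powr p (\<Sum>i<n. x1 p i) (\<Sum>i<n. x2 p i) (\<Sum>i<n. x3 p i) (\<Sum>i<n. x4 p i) powr (1/p)"
      unfolding pair[OF p1] using p by (intro powr_mono2 sum_nonneg sum0 sv_sum_powr_sum(2) x0) auto
  qed
qed

end
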